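(* For any functions $Z_1(s)\in\mathbb{R}^{d_1\times n}$ and $Z_2(s,\eta)\in\mathbb{R}^{d_2\times n}$, $s,\eta\in[a,b]$, suppose there exists a matrix $$T=\begin{bmatrix} T_{11}&T_{12}&T_{13}&T_{14} \\ T_{21}&T_{22}&T_{23}&T_{24} \\ T_{31}&T_{32}&T_{33}&T_{34} \\ T_{41}&T_{42}&T_{43}&T_{44} \end{bmatrix}\succcurlyeq 0$$ (symmetric positive semidefinite, with diagonal blocks $T_{11}\in\mathbb{R}^{m\times m}$, $T_{22}\in\mathbb{R}^{d_1\times d_1}$, $T_{33},T_{44}\in\mathbb{R}^{d_2\times d_2}$) such that \begin{align*} P&=T_{11},\\ Q(s)&=T_{12}Z_1(s)+\int_s^b T_{13}Z_2(\eta,s)\,d\eta+\int_a^s T_{14}Z_2(\eta,s)\,d\eta,\\ S(s)&=Z_1(s)^{\top}T_{22}Z_1(s),\\ R_1(s,\eta)&=Z_1(s)^{\top}T_{23}Z_2(s,\eta)+Z_2(\eta,s)^{\top}T_{42}Z_1(\eta)+\int_s^b Z_2(\theta,s)^{\top}T_{33}Z_2(\theta,\eta)\,d\theta\\ &\quad+\int_\eta^s Z_2(\theta,s)^{\top}T_{43}Z_2(\theta,\eta)\,d\theta+\int_a^\eta Z_2(\theta,s)^{\top}T_{44}Z_2(\theta,\eta)\,d\theta,\\ R_2(s,\eta)&=Z_1(s)^{\top}T_{24}Z_2(s,\eta)+Z_2(\eta,s)^{\top}T_{32}Z_1(\eta)+\int_\eta^b Z_2(\theta,s)^{\top}T_{33}Z_2(\theta,\eta)\,d\theta\\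 &\quad+\int_s^\eta Z_2(\theta,s)^{\top}T_{34}Z_2(\theta,\eta)\,d\theta+\int_a^s Z_2(\theta,s)^{\top}T_{44}Z_2(\theta,\eta)\,d\theta. \end{align*} Then the operator $\mathcal{P}_{\{P,Q,Q^{\top},S,R_1,R_2\}}$ on $\mathbb{R}^m\times L_2^n[a,b]$ is positive, i.e. $\mathcal{P}_{\{P,Q,Q^{\top},S,R_1,R_2\}}\succcurlyeq 0$.
   Context: $L_2^n[a,b]$ is the space of square integrable $\mathbb{R}^n$-valued functions on $[a,b]$, with $\langle x,y\rangle_{L_2}=\int_a^b x(s)^{\top}y(s)\,ds$. The inner product on $\mathbb{R}^m\times L_2^n[a,b]$ is $\langle (x_1,x_2),(y_1,y_2)\rangle=x_1^{\top}y_1+\langle x_2,y_2\rangle_{L_2}$. An operator $\mathcal{P}:X\to X$ on an inner product space $X$ is called positive, written $\mathcal{P}\succcurlyeq0$, if $\langle w,\mathcal{P}w\rangle_X\ge 0$ for all $w\in X$. For a matrix $P\in\mathbb{R}^{m\times m}$ and bounded polynomial functions $Q_1:[a,b]\to\mathbb{R}^{m\times n}$, $Q_2:[a,b]\to\mathbb{R}^{n\times m}$, $S:[a,b]\to\mathbb{R}^{n\times n}$, $R_1,R_2:[a,b]\times[a,b]\to\mathbb{R}^{n\times n}$, the operator $\mathcal{P}_{\{P,Q_1,Q_2,S,R_1,R_2\}}$ maps $(x,z)\in\mathbb{R}^m\times L_2^n[a,b]$ to the element of $\mathbb{R}^m\times L_2^n[a,b]$ with first component $Px+\int_a^b Q_1(s)z(s)\,ds$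 and second component $$s\mapsto Q_2(s)x+S(s)z(s)+\int_a^s R_1(s,\eta)z(\eta)\,d\eta+\int_s^b R_2(s,\eta)z(\eta)\,d\eta.$$ $Q^{\top}$ denotes $s\mapsto Q(s)^{\top}$.
   Formalization: As stated the claim fails when b−a>1; the formal theorem proves positivity with P=T11 if b−a≤1, and with (b−a)T11 in place of P on every interval; Z1 is assumed Borel and bounded, Z2 Borel and square integrable. *)

theory Defs
  imports "HOL-Analysis.Analysis"
begin

text \<open>Functions that are square integrable on a set. Equivalence classes are not formed: elements
  are Borel representatives, and every class has one. For matrices, \<^const>\<open>norm\<close> is the
  Frobenius norm.\<close>

definition square_integrable_on :: "'a::euclidean_space set \<Rightarrow> ('a \<Rightarrow> 'b::euclidean_space) set" where
  "square_integrable_on A =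
     {f. set_borel_measurable lborel A f \<and> set_integrable lborel A (\<lambda>x. (norm (f x))\<^sup>2)}"

text \<open>The inner product space of pairs in R^m and L_2^n[a,b].\<close>

definition RL2 :: "real \<Rightarrow> real \<Rightarrow> ((real^'m) \<times> (real \<Rightarrow> real^'n)) set" where
  "RL2 a b = UNIV \<times> square_integrable_on {a..b}"

definition RL2_inner ::
  "real \<Rightarrow> real \<Rightarrow> (real^'m) \<times> (real \<Rightarrow> real^'n) \<Rightarrow> (real^'m) \<times> (real \<Rightarrow> real^'n) \<Rightarrow> real" where
  "RL2_inner a b v w = fst v \<bullet> fst w + (LBINT s=a..b. snd v s \<bullet> snd w s)"

text \<open>Being a map from the space to itself is part of positivity; it is not vacuous, since
  \<open>PI_operator\<close> below is a total function on all pairs.\<close>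

definition positive_operator :: "'v set \<Rightarrow> ('v \<Rightarrow> 'v \<Rightarrow> real) \<Rightarrow> ('v \<Rightarrow> 'v) \<Rightarrow> bool" where
  "positive_operator X ip F \<longleftrightarrow> (\<forall>w\<in>X. F w \<in> X) \<and> (\<forall>w\<in>X. 0 \<le> ip w (F w))"

definition PI_operator ::
  "real \<Rightarrow> real \<Rightarrow> real^'m^'m \<Rightarrow> (real \<Rightarrow> real^'n^'m) \<Rightarrow> (real \<Rightarrow> real^'m^'n) \<Rightarrow> (real \<Rightarrow> real^'n^'n)
    \<Rightarrow> (real \<Rightarrow> real \<Rightarrow> real^'n^'n) \<Rightarrow> (real \<Rightarrow> real \<Rightarrow> real^'n^'n)
    \<Rightarrow> (real^'m) \<times> (real \<Rightarrow> real^'n) \<Rightarrow> (real^'m) \<times> (real \<Rightarrow> real^'n)" where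
  "PI_operator a b P Q1 Q2 S R1 R2 = (\<lambda>(x, z).
     (P *v x + (LBINT s=a..b. Q1 s *v z s),
      \<lambda>s. Q2 s *v x + S s *v z s
            + (LBINT \<eta>=a..s. R1 s \<eta> *v z \<eta>) + (LBINT \<eta>=s..b. R2 s \<eta> *v z \<eta>)))"

definition psd_matrix :: "real^'k^'k \<Rightarrow> bool" where
  "psd_matrix A \<longleftrightarrow> transpose A = A \<and> (\<forall>v. 0 \<le> v \<bullet> (A *v v))"

text \<open>Four by four block matrices are matrices indexed by a sum of four index types; the injections
  \<open>ix1\<close>, \<dots>, \<open>ix4\<close> select the summands, so that \<open>blk ix2 ix3 T\<close> is the block T_23.\<close>

definition ix1 :: "'p \<Rightarrow> 'p + 'q + 'r + 't" where "ix1 = Inl"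
definition ix2 :: "'q \<Rightarrow> 'p + 'q + 'r + 't" where "ix2 = Inr \<circ> Inl"
definition ix3 :: "'r \<Rightarrow> 'p + 'q + 'r + 't" where "ix3 = Inr \<circ> Inr \<circ> Inl"
definition ix4 :: "'t \<Rightarrow> 'p + 'q + 'r + 't" where "ix4 = Inr \<circ> Inr \<circ> Inr"

definition blk :: "('i \<Rightarrow> 'k) \<Rightarrow> ('j \<Rightarrow> 'k) \<Rightarrow> real^'k^'k \<Rightarrow> real^'j^'i" where
  "blk f g A = (\<chi> i j. A $ f i $ g j)"

text \<open>Normalisation of \<open>P\<close> in the main theorem. With \<open>V = (x, Z1 z, \<dots>)\<close> the vector built
  pointwise from \<open>(x, z)\<close>, the form \<open>\<integral> V(s) \<bullet> T V(s) ds\<close> contributes \<open>(b - a) T11\<close>, not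
  \<open>T11\<close>, to the finite dimensional block. With \<open>P = T11\<close> itself positivity holds when
  \<open>b - a \<le> 1\<close> and fails in general for every \<open>b - a > 1\<close>: take all dimensions 1,
  \<open>Z1 = 1\<close>, \<open>Z2 = 0\<close>, \<open>T11 = T12 = T21 = T22 = 1\<close> and all other blocks 0; at
  \<open>x = b - a\<close>, \<open>z = -1\<close> the form takes the value \<open>(b - a) (1 - (b - a))\<close>. The theorem
  therefore asserts positivity for \<open>T11\<close> when \<open>b - a \<le> 1\<close>, and for \<open>(b - a) T11\<close>
  on every interval.\<close>

end

theory Submission
  imports Defs
begin

text \<open>With \<open>V = (x, Z\<^sub>1 z, \<integral>\<^sub>a\<^sup>s Z\<^sub>2(s, \<eta>) z(\<eta>) d\<eta>, \<integral>\<^sub>s\<^sup>b Z\<^sub>2(s, \<eta>) z(\<eta>) d\<eta>)\<close>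
  the form of the operator with \<open>(b - a) T\<^sub>1\<^sub>1\<close> in place of \<open>T\<^sub>1\<^sub>1\<close> is \<open>\<integral> V(s) \<bullet> T V(s) ds \<ge> 0\<close>.
  Indeed \<open>V\<close> is the image of \<open>(x, z)\<close> under an operator \<open>\<V>\<close> of the form \<open>A(s) x + B(s) z(s) + \<integral> G(s, \<eta>) z(\<eta>) d\<eta>\<close>
  on all of \<open>\<real>\<close>, where \<open>G\<close> is the square integrable kernel with block row \<open>Z\<^sub>2\<close> in the third place below the
  diagonal and in the fourth place above it, and expanding \<open>\<V>\<^sup>* T \<V>\<close> by Fubini gives exactly the
  stated formulas. When \<open>b - a \<le> 1\<close> the term \<open>(1 - (b - a)) x \<bullet> T\<^sub>1\<^sub>1 x\<close> may be added.\<close>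

section \<open>Square integrable functions and kernels\<close>

text \<open>Stated over an arbitrary measure, so that one notion serves functions on the line and
  kernels on a product. Functions on the interval enter after truncation by an indicator.\<close>

definition square_integrable ::
  "'a measure \<Rightarrow> ('a \<Rightarrow> 'b::{banach, second_countable_topology}) \<Rightarrow> bool" where
  "square_integrable M f \<longleftrightarrow> f \<in> borel_measurable M \<and> integrable M (\<lambda>x. (norm (f x))\<^sup>2)"

lemma square_integrable_measurable: "square_integrable M f \<Longrightarrow> f \<in> borel_measurable M"
  by (simp add: square_integrable_def)

lemma borel_measurable_bilinear:
  fixes h :: "'b::{real_normed_vector, second_countable_topology} \<Rightarrow>
    'c::{real_normed_vector, second_countable_topology} \<Rightarrow> 'd::real_normed_vector"
  assumes "bounded_bilinear h" "f \<in> borel_measurable M" "g \<in> borel_measurable M"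
  shows "(\<lambda>x. h (f x) (g x)) \<in> borel_measurable M"
  using assms(2,3)
  by (rule borel_measurable_continuous_Pair)
    (intro bounded_bilinear.continuous_on[OF assms(1)] continuous_intros)

lemma square_integrable_bound:
  fixes f :: "'a \<Rightarrow> 'b::{banach, second_countable_topology}"
    and g :: "'a \<Rightarrow> 'c::{banach, second_countable_topology}"
  assumes "square_integrable M g" "f \<in> borel_measurable M" "AE x in M. norm (f x) \<le> C * norm (g x)"
  shows "square_integrable M f"
proof -
  note [measurable] = assms(2)
  have "integrable M (\<lambda>x. (norm (f x))\<^sup>2)"
  proof (rule Bochner_Integration.integrable_bound)
    show "integrable M (\<lambda>x. C\<^sup>2 * (norm (g x))\<^sup>2)"
      using assms(1) by (simp add: square_integrable_def)
    show "AE x in M. norm ((norm (f x))\<^sup>2) \<le> norm (C\<^sup>2 * (norm (g x))\<^sup>2)"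
      using assms(3)
    proof eventually_elim
      case (elim x)
      then have "(norm (f x))\<^sup>2 \<le> (C * norm (g x))\<^sup>2" by (intro power_mono) auto
      then show ?case by (simp add: power_mult_distrib)
    qed
  qed simp
  then show ?thesis using assms(2) by (simp add: square_integrable_def)
qed

lemma square_integrable_add:
  assumes "square_integrable M f" "square_integrable M g"
  shows "square_integrable M (\<lambda>x. f x + g x)"
proof -
  have [measurable]: "f \<in> borel_measurable M" "g \<in> borel_measurable M"
    using assms by (auto simp: square_integrable_def)
  have "integrable M (\<lambda>x. (norm (f x + g x))\<^sup>2)"
  proof (rule Bochner_Integration.integrable_bound)
    show "integrable M (\<lambda>x. 2 * (norm (f x))\<^sup>2 + 2 * (norm (g x))\<^sup>2)"
      using assms by (simp add: square_integrable_def)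
    have "(norm (f x + g x))\<^sup>2 \<le> 2 * (norm (f x))\<^sup>2 + 2 * (norm (g x))\<^sup>2" for x
    proof -
      have "(norm (f x + g x))\<^sup>2 \<le> (norm (f x) + norm (g x))\<^sup>2"
        by (intro power_mono norm_triangle_ineq) auto
      also have "\<dots> \<le> 2 * (norm (f x))\<^sup>2 + 2 * (norm (g x))\<^sup>2"
        using sum_squares_bound[of "norm (f x)" "norm (g x)"] by (simp add: power2_sum)
      finally show ?thesis .
    qed
    then show "AE x in M. norm ((norm (f x + g x))\<^sup>2) \<le> norm (2 * (norm (f x))\<^sup>2 + 2 * (norm (g x))\<^sup>2)"
      by simp
  qed simp
  then show ?thesis by (simp add: square_integrable_def)
qed

text \<open>The squares of the two norms dominate their product, since
  \<open>2 * u * v \<le> u^2 + v^2\<close>. The map \<open>h\<close> is kept abstract because inner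
  products, scalar multiples and several matrix products all occur later.\<close>

lemma square_integrable_bilinear_integrable:
  fixes h :: "'b::{banach, second_countable_topology} \<Rightarrow>
    'c::{banach, second_countable_topology} \<Rightarrow> 'd::{banach, second_countable_topology}"
  assumes "bounded_bilinear h" "square_integrable M f" "square_integrable M g"
  shows "integrable M (\<lambda>x. h (f x) (g x))"
proof -
  obtain K where K: "K > 0" "\<And>a b. norm (h a b) \<le> norm a * norm b * K"
    using bounded_bilinear.pos_bounded[OF assms(1)] by blast
  show ?thesis
  proof (rule Bochner_Integration.integrable_bound)
    show "integrable M (\<lambda>x. ((norm (f x))\<^sup>2 + (norm (g x))\<^sup>2) * K)"
      using assms by (simp add: square_integrable_def)
    show "(\<lambda>x. h (f x) (g x)) \<in> borel_measurable M"
      using assms by (intro borel_measurable_bilinear[OF assms(1)]) (auto simp: square_integrable_def)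
    have "norm (h (f x) (g x)) \<le> ((norm (f x))\<^sup>2 + (norm (g x))\<^sup>2) * K" for x
    proof -
      have "norm (f x) * norm (g x) \<le> (norm (f x))\<^sup>2 + (norm (g x))\<^sup>2"
        using sum_squares_bound[of "norm (f x)" "norm (g x)"]
          mult_nonneg_nonneg[OF norm_ge_zero[of "f x"] norm_ge_zero[of "g x"]] by linarith
      then show ?thesis using K(1) by (intro order_trans[OF K(2)] mult_right_mono) auto
    qed
    then show "AE x in M. norm (h (f x) (g x)) \<le> norm (((norm (f x))\<^sup>2 + (norm (g x))\<^sup>2) * K)"
      using K(1) by (simp add: order.strict_implies_order)
  qed
qed

lemma square_integrable_bounded_mult:
  fixes h :: "'b::{banach, second_countable_topology} \<Rightarrow>
    'c::{banach, second_countable_topology} \<Rightarrow> 'd::{banach, second_countable_topology}"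
  assumes "bounded_bilinear h" "f \<in> borel_measurable M" "bounded (range f)" "square_integrable M g"
  shows "square_integrable M (\<lambda>x. h (f x) (g x))"
proof -
  obtain K where K: "K > 0" "\<And>a b. norm (h a b) \<le> norm a * norm b * K"
    using bounded_bilinear.pos_bounded[OF assms(1)] by blast
  obtain C where C: "\<And>x. norm (f x) \<le> C"
    using assms(3) by (auto simp: bounded_iff)
  show ?thesis
  proof (rule square_integrable_bound[OF assms(4)])
    show "(\<lambda>x. h (f x) (g x)) \<in> borel_measurable M"
      using assms by (intro borel_measurable_bilinear[OF assms(1)]) (auto simp: square_integrable_def)
    have "norm (h (f x) (g x)) \<le> (C * K) * norm (g x)" for x
    proof -
      have "norm (f x) * norm (g x) * K \<le> C * norm (g x) * K"
        using K(1) C by (intro mult_right_mono) auto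
      then show ?thesis using K(2)[of "f x" "g x"] by (simp add: ac_simps)
    qed
    then show "AE x in M. norm (h (f x) (g x)) \<le> (C * K) * norm (g x)" by simp
  qed
qed

lemma square_integrable_linear:
  fixes l :: "'b::{banach, second_countable_topology} \<Rightarrow> 'c::{banach, second_countable_topology}"
  assumes "bounded_linear l" "square_integrable M f"
  shows "square_integrable M (\<lambda>x. l (f x))"
proof -
  obtain K where K: "\<And>a. norm (l a) \<le> norm a * K"
    using bounded_linear.bounded[OF assms(1)] by blast
  show ?thesis
  proof (rule square_integrable_bound[OF assms(2)])
    show "(\<lambda>x. l (f x)) \<in> borel_measurable M"
      using assms borel_measurable_continuous_onI[OF linear_continuous_on[OF assms(1)]]
        measurable_compose[of f M borel l borel]
      by (auto simp: square_integrable_def)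
    show "AE x in M. norm (l (f x)) \<le> K * norm (f x)"
      using K by (simp add: mult.commute)
  qed
qed

section \<open>Kernels on product measures: slices, Hilbert-Schmidt operators, Fubini\<close>

context pair_sigma_finite
begin

lemma square_integrable_swap:
  assumes "square_integrable (M1 \<Otimes>\<^sub>M M2) (case_prod G)"
  shows "square_integrable (M2 \<Otimes>\<^sub>M M1) (\<lambda>(y, x). G x y)"
proof -
  have "integrable (M2 \<Otimes>\<^sub>M M1) (\<lambda>(y, x). (\<lambda>p. (norm (case_prod G p))\<^sup>2) (x, y))"
    by (rule integrable_product_swap) (use assms in \<open>simp add: square_integrable_def\<close>)
  moreover have "(\<lambda>(y, x). case_prod G (x, y)) \<in> borel_measurable (M2 \<Otimes>\<^sub>M M1)"
    by (rule measurable_pair_swap) (use assms in \<open>simp add: square_integrable_def\<close>)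
  ultimately show ?thesis by (simp add: square_integrable_def split_def)
qed

text \<open>Fubini for the squared norm. The exceptional null set may be nonempty, which is why
  later kernel identities are asserted only almost everywhere.\<close>

lemma AE_square_integrable_fst:
  assumes "square_integrable (M1 \<Otimes>\<^sub>M M2) (case_prod G)"
  shows "AE x in M1. square_integrable M2 (G x)"
proof -
  have [measurable]: "case_prod G \<in> borel_measurable (M1 \<Otimes>\<^sub>M M2)"
    using assms by (simp add: square_integrable_def)
  have "AE x in M1. integrable M2 (\<lambda>y. (\<lambda>p. (norm (case_prod G p))\<^sup>2) (x, y))"
    by (rule AE_integrable_fst') (use assms in \<open>simp add: square_integrable_def\<close>)
  then show ?thesis
    using AE_space by eventually_elim (simp add: square_integrable_def)
qed

lemma AE_square_integrable_snd:
  assumes "square_integrable (M1 \<Otimes>\<^sub>M M2) (case_prod G)"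
  shows "AE y in M2. square_integrable M1 (\<lambda>x. G x y)"
proof -
  interpret Q: pair_sigma_finite M2 M1 ..
  show ?thesis using Q.AE_square_integrable_fst[OF square_integrable_swap[OF assms]] .
qed

lemma square_integrable_tensor:
  fixes H :: "'a \<Rightarrow> 'c::{banach, second_countable_topology}"
    and z :: "'b \<Rightarrow> 'd::{banach, second_countable_topology}"
  assumes "square_integrable M1 H" "square_integrable M2 z"
  shows "square_integrable (M1 \<Otimes>\<^sub>M M2) (\<lambda>(x, y). norm (H x) * norm (z y))"
proof -
  have [measurable]: "H \<in> borel_measurable M1" "z \<in> borel_measurable M2"
    using assms by (auto simp: square_integrable_def)
  have "integrable (M1 \<Otimes>\<^sub>M M2) (\<lambda>p. (norm (H (fst p)))\<^sup>2 * (norm (z (snd p)))\<^sup>2)"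
    by (rule Fubini_integrable) (use assms in \<open>auto simp: square_integrable_def\<close>)
  then show ?thesis by (simp add: square_integrable_def split_def power_mult_distrib)
qed

text \<open>Cauchy-Schwarz in the second variable bounds the squared integral by the squared norms
  of \<open>G x\<close> and \<open>z\<close>; integrating over the first variable leaves the squared
  norm of \<open>G\<close> on the product. Nonnegative extended integrals also cover slices of
  infinite norm.\<close>

lemma square_integrable_Hilbert_Schmidt:
  fixes h :: "'c::{banach, second_countable_topology} \<Rightarrow>
    'd::{banach, second_countable_topology} \<Rightarrow> 'e::{banach, second_countable_topology}"
  assumes h: "bounded_bilinear h"
    and G: "square_integrable (M1 \<Otimes>\<^sub>M M2) (case_prod G)" and z: "square_integrable M2 z"
  shows "square_integrable M1 (\<lambda>x. \<integral>y. h (G x y) (z y) \<partial>M2)"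
proof -
  have [measurable]: "case_prod G \<in> borel_measurable (M1 \<Otimes>\<^sub>M M2)" "z \<in> borel_measurable M2"
    using G z by (auto simp: square_integrable_def)
  obtain K where K: "K > 0" "\<And>a b. norm (h a b) \<le> norm a * norm b * K"
    using bounded_bilinear.pos_bounded[OF h] by blast
  have hm[measurable]: "(\<lambda>(x, y). h (G x y) (z y)) \<in> borel_measurable (M1 \<Otimes>\<^sub>M M2)"
    using borel_measurable_bilinear[OF h, of "\<lambda>p. case_prod G p" "M1 \<Otimes>\<^sub>M M2" "\<lambda>p. z (snd p)"]
    by (simp add: split_def)
  define c where "c = (\<integral>\<^sup>+y. ennreal ((norm (z y))\<^sup>2) \<partial>M2)"
  have c: "c < \<infinity>"
    using z by (simp add: c_def square_integrable_def integrable_iff_bounded)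
  have "(\<integral>\<^sup>+x. ennreal ((norm (\<integral>y. h (G x y) (z y) \<partial>M2))\<^sup>2) \<partial>M1)
      \<le> (\<integral>\<^sup>+x. (ennreal K)\<^sup>2 * ((\<integral>\<^sup>+y. ennreal ((norm (G x y))\<^sup>2) \<partial>M2) * c) \<partial>M1)"
  proof (rule nn_integral_mono)
    fix x assume x[simp]: "x \<in> space M1"
    \<comment> \<open>On a slice that is not integrable the Bochner integral is 0 by convention, and
      the bound is trivial.\<close>
    have "ennreal (norm (\<integral>y. h (G x y) (z y) \<partial>M2)) \<le> (\<integral>\<^sup>+y. ennreal (norm (h (G x y) (z y))) \<partial>M2)"
    proof (cases "integrable M2 (\<lambda>y. h (G x y) (z y))")
      case True
      then show ?thesis by (rule integral_norm_bound_ennreal)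
    qed (simp add: not_integrable_integral_eq)
    also have "\<dots> \<le> (\<integral>\<^sup>+y. ennreal K * (ennreal (norm (G x y)) * ennreal (norm (z y))) \<partial>M2)"
    proof (rule nn_integral_mono)
      fix y
      show "ennreal (norm (h (G x y) (z y))) \<le> ennreal K * (ennreal (norm (G x y)) * ennreal (norm (z y)))"
        using K(1) K(2)[of "G x y" "z y"] by (simp add: ennreal_mult[symmetric] mult_ac)
    qed
    also have "\<dots> = ennreal K * (\<integral>\<^sup>+y. ennreal (norm (G x y)) * ennreal (norm (z y)) \<partial>M2)"
      by (rule nn_integral_cmult) measurable
    finally have "(ennreal (norm (\<integral>y. h (G x y) (z y) \<partial>M2)))\<^sup>2
        \<le> (ennreal K * (\<integral>\<^sup>+y. ennreal (norm (G x y)) * ennreal (norm (z y)) \<partial>M2))\<^sup>2"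
      by (intro power_mono) auto
    also have "\<dots> \<le> (ennreal K)\<^sup>2 * ((\<integral>\<^sup>+y. (ennreal (norm (G x y)))\<^sup>2 \<partial>M2) * (\<integral>\<^sup>+y. (ennreal (norm (z y)))\<^sup>2 \<partial>M2))"
      unfolding power_mult_distrib by (intro mult_left_mono Cauchy_Schwarz_nn_integral) auto
    finally show "ennreal ((norm (\<integral>y. h (G x y) (z y) \<partial>M2))\<^sup>2)
        \<le> (ennreal K)\<^sup>2 * ((\<integral>\<^sup>+y. ennreal ((norm (G x y))\<^sup>2) \<partial>M2) * c)"
      by (simp add: c_def ennreal_power)
  qed
  also have "\<dots> = (ennreal K)\<^sup>2 * c * (\<integral>\<^sup>+x. (\<integral>\<^sup>+y. ennreal ((norm (G x y))\<^sup>2) \<partial>M2) \<partial>M1)"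
    by (simp add: nn_integral_cmult nn_integral_multc mult_ac)
  also have "(\<integral>\<^sup>+x. (\<integral>\<^sup>+y. ennreal ((norm (G x y))\<^sup>2) \<partial>M2) \<partial>M1) =
      (\<integral>\<^sup>+p. ennreal ((norm (case_prod G p))\<^sup>2) \<partial>(M1 \<Otimes>\<^sub>M M2))"
    by (subst M2.nn_integral_fst[symmetric]) auto
  also have "(ennreal K)\<^sup>2 * c * \<dots> < \<infinity>"
    using c G by (auto simp: square_integrable_def integrable_iff_bounded ennreal_mult_less_top power_less_top_ennreal)
  finally show ?thesis
    unfolding square_integrable_def by (auto intro!: integrableI_bounded)
qed

text \<open>The tensor \<open>norm (H x) * norm (z y)\<close> is square integrable on the product,
  so its product with \<open>G\<close> is integrable and Fubini applies to the trilinear integrand.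
  The hypothesis \<open>assoc\<close> covers both later uses: associativity of matrix products, and
  moving a matrix across an inner product to its transpose.\<close>

lemma Fubini_bilinear:
  fixes h1 :: "'c::{banach, second_countable_topology} \<Rightarrow>
      'd::{banach, second_countable_topology} \<Rightarrow> 'e::{banach, second_countable_topology}"
    and h2 :: "'f::{banach, second_countable_topology} \<Rightarrow> 'g::{banach, second_countable_topology} \<Rightarrow> 'd"
    and h3 :: "'h::{banach, second_countable_topology} \<Rightarrow> 'g \<Rightarrow> 'e"
    and h4 :: "'c \<Rightarrow> 'f \<Rightarrow> 'h"
  assumes h1: "bounded_bilinear h1" and h2: "bounded_bilinear h2"
    and h3: "bounded_bilinear h3" and h4: "bounded_bilinear h4"
    and assoc: "\<And>u g z. h1 u (h2 g z) = h3 (h4 u g) z"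
    and H: "square_integrable M1 H" and G: "square_integrable (M1 \<Otimes>\<^sub>M M2) (case_prod G)"
    and z: "square_integrable M2 z"
  shows "integrable M2 (\<lambda>y. h3 (\<integral>x. h4 (H x) (G x y) \<partial>M1) (z y))"
    and "(\<integral>x. h1 (H x) (\<integral>y. h2 (G x y) (z y) \<partial>M2) \<partial>M1)
      = (\<integral>y. h3 (\<integral>x. h4 (H x) (G x y) \<partial>M1) (z y) \<partial>M2)"
proof -
  have [measurable]: "H \<in> borel_measurable M1" "case_prod G \<in> borel_measurable (M1 \<Otimes>\<^sub>M M2)"
      "z \<in> borel_measurable M2"
    using H G z by (auto simp: square_integrable_def)
  define f where "f = (\<lambda>x y. h1 (H x) (h2 (G x y) (z y)))"
  have m2[measurable]: "(\<lambda>p. h2 (case_prod G p) (z (snd p))) \<in> borel_measurable (M1 \<Otimes>\<^sub>M M2)"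
    by (rule borel_measurable_bilinear[OF h2]) auto
  have m4[measurable]: "(\<lambda>p. h4 (H (fst p)) (case_prod G p)) \<in> borel_measurable (M1 \<Otimes>\<^sub>M M2)"
    by (rule borel_measurable_bilinear[OF h4]) auto
  have fm: "(\<lambda>p. h1 (H (fst p)) (h2 (case_prod G p) (z (snd p)))) \<in> borel_measurable (M1 \<Otimes>\<^sub>M M2)"
    by (rule borel_measurable_bilinear[OF h1]) auto
  obtain K1 where K1: "K1 > 0" "\<And>a b. norm (h1 a b) \<le> norm a * norm b * K1"
    using bounded_bilinear.pos_bounded[OF h1] by blast
  obtain K2 where K2: "K2 > 0" "\<And>a b. norm (h2 a b) \<le> norm a * norm b * K2"
    using bounded_bilinear.pos_bounded[OF h2] by blast
  have f: "integrable (M1 \<Otimes>\<^sub>M M2) (case_prod f)"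
  proof (rule Bochner_Integration.integrable_bound)
    \<comment> \<open>The dominating function is written as a scalar multiple of two square
      integrable functions on the product, the tensor and the kernel, so that the bilinear
      integrability lemma applies to it.\<close>
    show "integrable (M1 \<Otimes>\<^sub>M M2)
        (\<lambda>p. K1 * K2 * norm ((case p of (x, y) \<Rightarrow> norm (H x) * norm (z y)) *\<^sub>R case_prod G p))"
      by (intro integrable_mult_right integrable_norm
          square_integrable_bilinear_integrable[OF bounded_bilinear_scaleR] square_integrable_tensor H G z)
    show "case_prod f \<in> borel_measurable (M1 \<Otimes>\<^sub>M M2)"
      using fm by (simp add: f_def split_def)
    have "norm (f x y) \<le> K1 * K2 * (norm (H x) * norm (z y) * norm (G x y))" for x y
    proof -
      have "norm (f x y) \<le> norm (H x) * norm (h2 (G x y) (z y)) * K1"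
        unfolding f_def by (rule K1)
      also have "\<dots> \<le> norm (H x) * (norm (G x y) * norm (z y) * K2) * K1"
        using K1(1) by (intro mult_right_mono mult_left_mono K2) auto
      finally show ?thesis by (simp add: mult_ac)
    qed
    then show "AE p in M1 \<Otimes>\<^sub>M M2. norm (case_prod f p) \<le>
        norm (K1 * K2 * norm ((case p of (x, y) \<Rightarrow> norm (H x) * norm (z y)) *\<^sub>R case_prod G p))"
      using K1(1) K2(1) by (intro always_eventually allI) (simp add: abs_mult split_def)
  qed
  \<comment> \<open>A square integrable slice makes the inner integrand integrable, and then the
    bounded linear map \<open>h1 (H x)\<close> passes through the integral. Since this is known only
    for almost every slice, measurability of the two sides is established separately below.\<close>
  have 1: "AE x in M1. h1 (H x) (\<integral>y. h2 (G x y) (z y) \<partial>M2) = (\<integral>y. f x y \<partial>M2)"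
    using AE_square_integrable_fst[OF G]
  proof eventually_elim
    case (elim x)
    show ?case unfolding f_def
      by (rule integral_bounded_linear[symmetric, OF bounded_bilinear.bounded_linear_right[OF h1]])
        (rule square_integrable_bilinear_integrable[OF h2 elim z])
  qed
  have 2: "AE y in M2. h3 (\<integral>x. h4 (H x) (G x y) \<partial>M1) (z y) = (\<integral>x. f x y \<partial>M1)"
    using AE_square_integrable_snd[OF G]
  proof eventually_elim
    case (elim y)
    show ?case unfolding f_def assoc
      by (rule integral_bounded_linear[symmetric, OF bounded_bilinear.bounded_linear_left[OF h3]])
        (rule square_integrable_bilinear_integrable[OF h4 H elim])
  qed
  have "(\<lambda>x. \<integral>y. h2 (G x y) (z y) \<partial>M2) \<in> borel_measurable M1"
    using M2.borel_measurable_lebesgue_integral[of "\<lambda>x y. h2 (G x y) (z y)" M1] m2 by (simp add: split_def)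
  then have m1: "(\<lambda>x. h1 (H x) (\<integral>y. h2 (G x y) (z y) \<partial>M2)) \<in> borel_measurable M1"
    by (intro borel_measurable_bilinear[OF h1]) auto
  have "(\<lambda>(y, x). h4 (H x) (G x y)) \<in> borel_measurable (M2 \<Otimes>\<^sub>M M1)"
    using measurable_pair_swap[OF m4] by (simp add: split_def)
  then have "(\<lambda>y. \<integral>x. h4 (H x) (G x y) \<partial>M1) \<in> borel_measurable M2"
    using M1.borel_measurable_lebesgue_integral[of "\<lambda>y x. h4 (H x) (G x y)" M2] by simp
  then have m3: "(\<lambda>y. h3 (\<integral>x. h4 (H x) (G x y) \<partial>M1) (z y)) \<in> borel_measurable M2"
    by (intro borel_measurable_bilinear[OF h3]) auto
  have int2: "integrable M2 (\<lambda>y. \<integral>x. f x y \<partial>M1)"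
    by (rule integrable_snd[OF f])
  show "integrable M2 (\<lambda>y. h3 (\<integral>x. h4 (H x) (G x y) \<partial>M1) (z y))"
    using integrable_cong_AE[OF m3 borel_measurable_integrable[OF int2] 2] int2 by simp
  have "(\<integral>x. h1 (H x) (\<integral>y. h2 (G x y) (z y) \<partial>M2) \<partial>M1) = (\<integral>x. (\<integral>y. f x y \<partial>M2) \<partial>M1)"
    by (rule integral_cong_AE[OF m1 _ 1]) (rule borel_measurable_integrable[OF integrable_fst[OF f]])
  also have "\<dots> = (\<integral>y. (\<integral>x. f x y \<partial>M1) \<partial>M2)"
    by (rule Fubini_integral[OF f, symmetric])
  also have "\<dots> = (\<integral>y. h3 (\<integral>x. h4 (H x) (G x y) \<partial>M1) (z y) \<partial>M2)"
    by (rule integral_cong_AE[symmetric, OF m3 borel_measurable_integrable[OF int2] 2])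
  finally show "(\<integral>x. h1 (H x) (\<integral>y. h2 (G x y) (z y) \<partial>M2) \<partial>M1)
      = (\<integral>y. h3 (\<integral>x. h4 (H x) (G x y) \<partial>M1) (z y) \<partial>M2)" .
qed

end

section \<open>Operators factored through a positive semidefinite matrix\<close>

lemma bounded_bilinear_matrix_vector_mult:
  "bounded_bilinear ((*v) :: real^'n^'m \<Rightarrow> real^'n \<Rightarrow> real^'m)"
  unfolding bilinear_conv_bounded_bilinear[symmetric] bilinear_def
  by (auto intro!: linearI simp: matrix_vector_mult_add_rdistrib matrix_vector_right_distrib
      scaleR_matrix_vector_assoc matrix_vector_mult_scaleR)

lemma matrix_add_rdistrib: "(A + B) ** C = A ** C + B ** C"
  for A B :: "'a::semiring_1^'n^'m" and C :: "'a^'p^'n"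
  by (simp add: vec_eq_iff matrix_matrix_mult_def sum.distrib distrib_right)

lemma bounded_bilinear_matrix_matrix_mult:
  "bounded_bilinear ((**) :: real^'n^'m \<Rightarrow> real^'p^'n \<Rightarrow> real^'p^'m)"
  unfolding bilinear_conv_bounded_bilinear[symmetric] bilinear_def
  by (auto intro!: linearI simp: matrix_add_ldistrib matrix_add_rdistrib
      scalar_matrix_assoc matrix_scalar_ac)

lemma bounded_linear_transpose: "bounded_linear (transpose :: real^'n^'m \<Rightarrow> real^'m^'n)"
  unfolding linear_conv_bounded_linear[symmetric]
  by (auto intro!: linearI simp: transpose_def vec_eq_iff)

lemma inner_matrix_vector_mult: "(A *v x) \<bullet> y = x \<bullet> (transpose A *v y)" for A :: "real^'n^'m"
  by (metis dot_lmul_matrix inner_commute matrix_transpose_mul transpose_matrix_vector)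

lemma bounded_bilinear_transpose_vector_mult:
  "bounded_bilinear (\<lambda>(A :: real^'n^'m) v. transpose A *v v)"
  by (rule bounded_bilinear.comp
      [OF bounded_bilinear_matrix_vector_mult bounded_linear_transpose bounded_linear_ident])

text \<open>Absorbing the fixed matrix \<open>T\<close> into the map leaves two varying factors, so
  that the results on products of square integrable functions apply to products weighted by
  \<open>T\<close>.\<close>

lemma bounded_bilinear_transpose_mult:
  fixes T :: "real^'k^'k"
  shows "bounded_bilinear (\<lambda>(U :: real^'p^'k) v. transpose U *v (T *v v))"
    and "bounded_bilinear (\<lambda>(U :: real^'p^'k) (g :: real^'q^'k). transpose U ** T ** g)"
  by (rule bounded_bilinear.comp[OF bounded_bilinear_matrix_vector_mult bounded_linear_transpose
        bounded_bilinear.bounded_linear_right[OF bounded_bilinear_matrix_vector_mult]])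
    (rule bounded_bilinear.comp[OF bounded_bilinear_matrix_matrix_mult
        bounded_linear_compose[OF bounded_bilinear.bounded_linear_left
          [OF bounded_bilinear_matrix_matrix_mult] bounded_linear_transpose] bounded_linear_ident])

section \<open>The composition of an operator, the matrix \<open>T\<close> and the adjoint
  operator\<close>

locale PI_factorisation = sigma_finite_measure M for M :: "'a measure" +
  fixes A :: "'a \<Rightarrow> real^'m^'k" and B :: "'a \<Rightarrow> real^'n^'k" and G :: "'a \<Rightarrow> 'a \<Rightarrow> real^'n^'k"
    and T :: "real^'k^'k"
  assumes A: "square_integrable M A"
    and B: "B \<in> borel_measurable M" and B_bounded: "bounded (range B)"
    and G: "square_integrable (M \<Otimes>\<^sub>M M) (case_prod G)"
    and T_symmetric: "transpose T = T" and T_nonneg: "\<And>v. 0 \<le> v \<bullet> (T *v v)"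
begin

text \<open>\<open>Pk\<close>, \<open>Qk\<close> and \<open>Rk\<close>, together with the multiplier
  \<open>transpose (B s) ** T ** B s\<close>, are the coefficients of the expanded composition: the
  finite dimensional block, the coupling term and the integral kernel.\<close>

definition Pk :: "real^'m^'m" where
  "Pk = (\<integral>\<theta>. transpose (A \<theta>) ** T ** A \<theta> \<partial>M)"

definition Qk :: "'a \<Rightarrow> real^'n^'m" where
  "Qk s = transpose (A s) ** T ** B s + (\<integral>\<theta>. transpose (A \<theta>) ** T ** G \<theta> s \<partial>M)"

definition Rk :: "'a \<Rightarrow> 'a \<Rightarrow> real^'n^'n" where
  "Rk s \<eta> = transpose (B s) ** T ** G s \<eta> + transpose (G \<eta> s) ** T ** B \<eta>
     + (\<integral>\<theta>. transpose (G \<theta> s) ** T ** G \<theta> \<eta> \<partial>M)"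

definition V :: "real^'m \<Rightarrow> ('a \<Rightarrow> real^'n) \<Rightarrow> 'a \<Rightarrow> real^'k" where
  "V x z s = A s *v x + B s *v z s + (\<integral>\<eta>. G s \<eta> *v z \<eta> \<partial>M)"

text \<open>The function component of the adjoint applied to \<open>T *v V x z\<close>; the adjoint
  of an integral operator integrates the transposed kernel over its first variable.\<close>

definition W :: "real^'m \<Rightarrow> ('a \<Rightarrow> real^'n) \<Rightarrow> 'a \<Rightarrow> real^'n" where
  "W x z s = transpose (B s) *v (T *v V x z s) + (\<integral>\<theta>. transpose (G \<theta> s) *v (T *v V x z \<theta>) \<partial>M)"

lemma pair_self: "pair_sigma_finite M M" ..

context
  fixes z :: "'a \<Rightarrow> real^'n" and x :: "real^'m"
  assumes z: "square_integrable M z"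
begin

lemma square_integrable_parts:
  "square_integrable M (\<lambda>s. A s *v x)" "square_integrable M (\<lambda>s. B s *v z s)"
  "square_integrable M (\<lambda>s. \<integral>\<eta>. G s \<eta> *v z \<eta> \<partial>M)" "square_integrable M (V x z)"
  "square_integrable M (\<lambda>s. T *v V x z s)"
proof -
  show 1: "square_integrable M (\<lambda>s. A s *v x)"
    by (rule square_integrable_linear[OF _ A])
      (rule bounded_bilinear.bounded_linear_left[OF bounded_bilinear_matrix_vector_mult])
  show 2: "square_integrable M (\<lambda>s. B s *v z s)"
    by (rule square_integrable_bounded_mult[OF bounded_bilinear_matrix_vector_mult B B_bounded z])
  show 3: "square_integrable M (\<lambda>s. \<integral>\<eta>. G s \<eta> *v z \<eta> \<partial>M)"
    by (rule pair_sigma_finite.square_integrable_Hilbert_Schmidt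
        [OF pair_self bounded_bilinear_matrix_vector_mult G z])
  show 4: "square_integrable M (V x z)"
    unfolding V_def by (intro square_integrable_add 1 2 3)
  show "square_integrable M (\<lambda>s. T *v V x z s)"
    by (rule square_integrable_linear[OF _ 4])
      (rule bounded_bilinear.bounded_linear_right[OF bounded_bilinear_matrix_vector_mult])
qed

text \<open>Applied with \<open>H = A\<close> and with the slices \<open>H = G(-, s)\<close>, which yields the two components
  of \<open>\<V>\<^sup>* T \<V>\<close>.\<close>

lemma integral_transpose_V:
  fixes H :: "'a \<Rightarrow> real^'p^'k"
  assumes H: "square_integrable M H"
  shows "integrable M (\<lambda>\<theta>. transpose (H \<theta>) ** T ** A \<theta>)"
    "integrable M (\<lambda>\<eta>. (transpose (H \<eta>) ** T ** B \<eta>) *v z \<eta>)"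
    "integrable M (\<lambda>\<eta>. (\<integral>\<theta>. transpose (H \<theta>) ** T ** G \<theta> \<eta> \<partial>M) *v z \<eta>)"
    "(\<integral>\<theta>. transpose (H \<theta>) *v (T *v V x z \<theta>) \<partial>M)
      = (\<integral>\<theta>. transpose (H \<theta>) ** T ** A \<theta> \<partial>M) *v x
        + (\<integral>\<eta>. (transpose (H \<eta>) ** T ** B \<eta>) *v z \<eta> \<partial>M)
        + (\<integral>\<eta>. (\<integral>\<theta>. transpose (H \<theta>) ** T ** G \<theta> \<eta> \<partial>M) *v z \<eta> \<partial>M)"
proof -
  note h = bounded_bilinear_transpose_mult[where T = T]
  have assoc: "transpose U *v (T *v (g *v v)) = (transpose U ** T ** g) *v v"
    for U :: "real^'p^'k" and g :: "real^'q^'k" and v :: "real^'q"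
    by (simp add: matrix_vector_mul_assoc matrix_mul_assoc)
  show 1: "integrable M (\<lambda>\<theta>. transpose (H \<theta>) ** T ** A \<theta>)"
    by (rule square_integrable_bilinear_integrable[OF h(2) H A])
  have 2: "integrable M (\<lambda>\<eta>. transpose (H \<eta>) *v (T *v (B \<eta> *v z \<eta>)))"
    by (rule square_integrable_bilinear_integrable[OF h(1) H square_integrable_parts(2)])
  then show "integrable M (\<lambda>\<eta>. (transpose (H \<eta>) ** T ** B \<eta>) *v z \<eta>)"
    unfolding assoc .
  have 3: "integrable M (\<lambda>\<theta>. transpose (H \<theta>) *v (T *v (\<integral>\<eta>. G \<theta> \<eta> *v z \<eta> \<partial>M)))"
    by (rule square_integrable_bilinear_integrable[OF h(1) H square_integrable_parts(3)])
  note F = pair_sigma_finite.Fubini_bilinear[OF pair_self h(1) bounded_bilinear_matrix_vector_mult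
      bounded_bilinear_matrix_vector_mult h(2) assoc H G z]
  show "integrable M (\<lambda>\<eta>. (\<integral>\<theta>. transpose (H \<theta>) ** T ** G \<theta> \<eta> \<partial>M) *v z \<eta>)"
    by (rule F(1))
  have 4: "integrable M (\<lambda>\<theta>. transpose (H \<theta>) *v (T *v (A \<theta> *v x)))"
    by (rule square_integrable_bilinear_integrable[OF h(1) H square_integrable_parts(1)])
  have "(\<integral>\<theta>. transpose (H \<theta>) *v (T *v V x z \<theta>) \<partial>M) =
     (\<integral>\<theta>. transpose (H \<theta>) *v (T *v (A \<theta> *v x)) + transpose (H \<theta>) *v (T *v (B \<theta> *v z \<theta>))
       + transpose (H \<theta>) *v (T *v (\<integral>\<eta>. G \<theta> \<eta> *v z \<eta> \<partial>M)) \<partial>M)"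
    by (simp add: V_def matrix_vector_right_distrib)
  also have "\<dots> = (\<integral>\<theta>. transpose (H \<theta>) *v (T *v (A \<theta> *v x)) \<partial>M)
      + (\<integral>\<theta>. transpose (H \<theta>) *v (T *v (B \<theta> *v z \<theta>)) \<partial>M)
      + (\<integral>\<theta>. transpose (H \<theta>) *v (T *v (\<integral>\<eta>. G \<theta> \<eta> *v z \<eta> \<partial>M)) \<partial>M)"
    using 2 3 4 by simp
  also have "(\<integral>\<theta>. transpose (H \<theta>) *v (T *v (\<integral>\<eta>. G \<theta> \<eta> *v z \<eta> \<partial>M)) \<partial>M)
      = (\<integral>\<eta>. (\<integral>\<theta>. transpose (H \<theta>) ** T ** G \<theta> \<eta> \<partial>M) *v z \<eta> \<partial>M)"
    by (rule F(2))
  also have "(\<integral>\<theta>. transpose (H \<theta>) *v (T *v (A \<theta> *v x)) \<partial>M)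
      = (\<integral>\<theta>. transpose (H \<theta>) ** T ** A \<theta> \<partial>M) *v x"
    unfolding assoc
    by (rule integral_bounded_linear[OF bounded_bilinear.bounded_linear_left
          [OF bounded_bilinear_matrix_vector_mult] 1])
  finally show "(\<integral>\<theta>. transpose (H \<theta>) *v (T *v V x z \<theta>) \<partial>M)
      = (\<integral>\<theta>. transpose (H \<theta>) ** T ** A \<theta> \<partial>M) *v x
        + (\<integral>\<eta>. (transpose (H \<eta>) ** T ** B \<eta>) *v z \<eta> \<partial>M)
        + (\<integral>\<eta>. (\<integral>\<theta>. transpose (H \<theta>) ** T ** G \<theta> \<eta> \<partial>M) *v z \<eta> \<partial>M)"
    by (simp only: assoc)
qed

lemma integral_A_V:
  "integrable M (\<lambda>\<eta>. Qk \<eta> *v z \<eta>)"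
  "(\<integral>\<theta>. transpose (A \<theta>) *v (T *v V x z \<theta>) \<partial>M) = Pk *v x + (\<integral>\<eta>. Qk \<eta> *v z \<eta> \<partial>M)"
  using integral_transpose_V[OF A]
  by (simp_all add: Pk_def Qk_def matrix_vector_mult_add_rdistrib)

text \<open>The adjoint kernel is \<open>G\<close> transposed with its variables exchanged, hence
  again Hilbert-Schmidt. This is what later makes the operator map the space into itself.\<close>

lemma square_integrable_W: "square_integrable M (W x z)"
proof -
  interpret pair_sigma_finite M M by (rule pair_self)
  have U: "square_integrable M (\<lambda>s. T *v V x z s)" by (rule square_integrable_parts)
  have "square_integrable M (\<lambda>s. transpose (B s) *v (T *v V x z s))"
    by (rule square_integrable_bounded_mult[OF bounded_bilinear_transpose_vector_mult B B_bounded U])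
  moreover have "square_integrable M (\<lambda>s. \<integral>\<theta>. transpose (G \<theta> s) *v (T *v V x z \<theta>) \<partial>M)"
    by (rule square_integrable_Hilbert_Schmidt[OF bounded_bilinear_transpose_vector_mult _ U])
      (rule square_integrable_swap[OF G])
  ultimately show ?thesis
    unfolding W_def by (rule square_integrable_add)
qed

text \<open>For almost every \<open>s\<close> both slices of \<open>G\<close> through
  \<open>s\<close> are square integrable. The slice in the second variable lets
  \<open>transpose (B s) ** T\<close> move under the integral; the slice in the first variable
  serves as \<open>H\<close> in \<open>integral_transpose_V\<close>.\<close>

lemma AE_W:
  "AE s in M. integrable M (\<lambda>\<eta>. Rk s \<eta> *v z \<eta>) \<and>
     W x z s = transpose (Qk s) *v x + (transpose (B s) ** T ** B s) *v z s
       + (\<integral>\<eta>. Rk s \<eta> *v z \<eta> \<partial>M)"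
proof -
  interpret pair_sigma_finite M M by (rule pair_self)
  show ?thesis
    using AE_square_integrable_fst[OF G] AE_square_integrable_snd[OF G]
  proof eventually_elim
    case (elim s)
    note I = integral_transpose_V[OF elim(2)]
    have Gz: "integrable M (\<lambda>\<eta>. G s \<eta> *v z \<eta>)"
      by (rule square_integrable_bilinear_integrable[OF bounded_bilinear_matrix_vector_mult elim(1) z])
    have lin: "bounded_linear (\<lambda>v. (transpose (B s) ** T) *v v)"
      by (rule bounded_bilinear.bounded_linear_right[OF bounded_bilinear_matrix_vector_mult])
    have BGz: "integrable M (\<lambda>\<eta>. (transpose (B s) ** T ** G s \<eta>) *v z \<eta>)"
      "(\<integral>\<eta>. (transpose (B s) ** T ** G s \<eta>) *v z \<eta> \<partial>M)
        = (transpose (B s) ** T) *v (\<integral>\<eta>. G s \<eta> *v z \<eta> \<partial>M)"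
      using integrable_bounded_linear[OF lin Gz] integral_bounded_linear[OF lin Gz]
      by (simp_all add: matrix_vector_mul_assoc)
    \<comment> \<open>Symmetry of \<open>T\<close> enters here: it makes the coupling from the
      vector to the function component the transpose of \<open>Qk\<close>.\<close>
    have tr: "transpose (transpose X ** T ** Y) = transpose Y ** T ** X"
      for X :: "real^'p^'k" and Y :: "real^'q^'k"
      by (simp add: matrix_transpose_mul T_symmetric matrix_mul_assoc)
    have AG: "integrable M (\<lambda>\<theta>. transpose (A \<theta>) ** T ** G \<theta> s)"
      by (rule square_integrable_bilinear_integrable[OF bounded_bilinear_transpose_mult(2) A elim(2)])
    have Q: "transpose (Qk s) = transpose (B s) ** T ** A s + (\<integral>\<theta>. transpose (G \<theta> s) ** T ** A \<theta> \<partial>M)"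
      unfolding Qk_def linear_add[OF bounded_linear.linear[OF bounded_linear_transpose]] tr
        integral_bounded_linear[OF bounded_linear_transpose AG, symmetric] ..
    have R: "Rk s \<eta> *v z \<eta> = (transpose (B s) ** T ** G s \<eta>) *v z \<eta>
        + (transpose (G \<eta> s) ** T ** B \<eta>) *v z \<eta>
        + (\<integral>\<theta>. transpose (G \<theta> s) ** T ** G \<theta> \<eta> \<partial>M) *v z \<eta>" for \<eta>
      by (simp add: Rk_def matrix_vector_mult_add_rdistrib)
    have "integrable M (\<lambda>\<eta>. Rk s \<eta> *v z \<eta>)"
      unfolding R by (intro Bochner_Integration.integrable_add BGz(1) I(2,3))
    moreover have "(\<integral>\<eta>. Rk s \<eta> *v z \<eta> \<partial>M) = (transpose (B s) ** T) *v (\<integral>\<eta>. G s \<eta> *v z \<eta> \<partial>M)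
        + (\<integral>\<eta>. (transpose (G \<eta> s) ** T ** B \<eta>) *v z \<eta> \<partial>M)
        + (\<integral>\<eta>. (\<integral>\<theta>. transpose (G \<theta> s) ** T ** G \<theta> \<eta> \<partial>M) *v z \<eta> \<partial>M)"
      unfolding R BGz(2)[symmetric] using BGz(1) I(2,3) by simp
    ultimately show ?case
      unfolding W_def I(4) Q
      by (simp add: V_def matrix_vector_right_distrib matrix_vector_mult_add_rdistrib
          matrix_vector_mul_assoc matrix_mul_assoc)
  qed
qed

text \<open>Pairing \<open>(x, z)\<close> with the adjoint of \<open>T *v V x z\<close> is pairing
  \<open>V x z\<close> with \<open>T *v V x z\<close>. The terms with \<open>A\<close> and
  \<open>B\<close> cross the inner product pointwise, the term with \<open>G\<close> by
  Fubini.\<close>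

lemma quadratic_form_eq:
  "x \<bullet> (Pk *v x + (\<integral>\<eta>. Qk \<eta> *v z \<eta> \<partial>M)) + (\<integral>s. z s \<bullet> W x z s \<partial>M)
    = (\<integral>s. V x z s \<bullet> (T *v V x z s) \<partial>M)"
proof -
  interpret pair_sigma_finite M M by (rule pair_self)
  define U where "U = (\<lambda>s. T *v V x z s)"
  note sq = square_integrable_parts(1-3) square_integrable_parts(5)[folded U_def]
  note inner_int = square_integrable_bilinear_integrable[OF bounded_bilinear_inner]
  have h: "bounded_bilinear (\<lambda>u (g :: real^'n^'k). transpose g *v u)"
    by (rule bounded_bilinear.flip[OF bounded_bilinear_transpose_vector_mult])
  have assoc: "u \<bullet> (g *v v) = (transpose g *v u) \<bullet> v" for g :: "real^'n^'k" and u v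
    by (metis inner_commute inner_matrix_vector_mult)
  \<comment> \<open>\<open>U\<close> takes the place of \<open>H\<close>, and \<open>h\<close> is
    the transposed product with its arguments flipped; the resulting identity moves \<open>G\<close>
    from \<open>z\<close> onto \<open>U\<close>.\<close>
  note F = Fubini_bilinear[OF bounded_bilinear_inner bounded_bilinear_matrix_vector_mult
      bounded_bilinear_inner h assoc sq(4) G z]
  have AU: "integrable M (\<lambda>s. transpose (A s) *v U s)"
    by (rule square_integrable_bilinear_integrable[OF bounded_bilinear_transpose_vector_mult A sq(4)])
  have "(\<integral>s. V x z s \<bullet> U s \<partial>M)
      = (\<integral>s. (A s *v x) \<bullet> U s + (B s *v z s) \<bullet> U s + U s \<bullet> (\<integral>\<eta>. G s \<eta> *v z \<eta> \<partial>M) \<partial>M)"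
    unfolding V_def by (simp add: inner_add_left inner_add_right inner_commute)
  also have "\<dots> = (\<integral>s. (A s *v x) \<bullet> U s \<partial>M) + (\<integral>s. (B s *v z s) \<bullet> U s \<partial>M)
      + (\<integral>s. U s \<bullet> (\<integral>\<eta>. G s \<eta> *v z \<eta> \<partial>M) \<partial>M)"
    by (simp add: inner_int sq)
  also have "(\<integral>s. (A s *v x) \<bullet> U s \<partial>M) = x \<bullet> (\<integral>s. transpose (A s) *v U s \<partial>M)"
    unfolding inner_matrix_vector_mult using AU by simp
  also have "(\<integral>s. transpose (A s) *v U s \<partial>M) = Pk *v x + (\<integral>\<eta>. Qk \<eta> *v z \<eta> \<partial>M)"
    unfolding U_def by (rule integral_A_V)
  also have "(\<integral>s. U s \<bullet> (\<integral>\<eta>. G s \<eta> *v z \<eta> \<partial>M) \<partial>M)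
      = (\<integral>\<eta>. (\<integral>s. transpose (G s \<eta>) *v U s \<partial>M) \<bullet> z \<eta> \<partial>M)"
    by (rule F(2))
  also have "x \<bullet> (Pk *v x + (\<integral>\<eta>. Qk \<eta> *v z \<eta> \<partial>M)) + (\<integral>s. (B s *v z s) \<bullet> U s \<partial>M)
      + (\<integral>\<eta>. (\<integral>s. transpose (G s \<eta>) *v U s \<partial>M) \<bullet> z \<eta> \<partial>M)
      = x \<bullet> (Pk *v x + (\<integral>\<eta>. Qk \<eta> *v z \<eta> \<partial>M))
        + (\<integral>s. (B s *v z s) \<bullet> U s + (\<integral>\<theta>. transpose (G \<theta> s) *v U \<theta> \<partial>M) \<bullet> z s \<partial>M)"
    using F(1) by (simp add: inner_int sq)
  also have "(\<lambda>s. (B s *v z s) \<bullet> U s + (\<integral>\<theta>. transpose (G \<theta> s) *v U \<theta> \<partial>M) \<bullet> z s) = (\<lambda>s. z s \<bullet> W x z s)"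
    unfolding W_def U_def[symmetric]
    by (simp add: inner_matrix_vector_mult inner_add_right inner_commute U_def)
  finally show ?thesis by (simp add: U_def)
qed

lemma quadratic_form_nonneg:
  "0 \<le> x \<bullet> (Pk *v x + (\<integral>\<eta>. Qk \<eta> *v z \<eta> \<partial>M)) + (\<integral>s. z s \<bullet> W x z s \<partial>M)"
  unfolding quadratic_form_eq by (intro Bochner_Integration.integral_nonneg T_nonneg)

end

end

section \<open>The operator on an interval\<close>

lemma borel_measurable_matrix_vector_mult [measurable (raw)]:
  fixes A :: "'a \<Rightarrow> real^'n^'m"
  assumes "A \<in> borel_measurable M" "v \<in> borel_measurable M"
  shows "(\<lambda>x. A x *v v x) \<in> borel_measurable M"
  by (rule borel_measurable_bilinear[OF bounded_bilinear_matrix_vector_mult assms])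

lemma borel_measurable_matrix_matrix_mult [measurable (raw)]:
  fixes A :: "'a \<Rightarrow> real^'n^'m" and B :: "'a \<Rightarrow> real^'p^'n"
  assumes "A \<in> borel_measurable M" "B \<in> borel_measurable M"
  shows "(\<lambda>x. A x ** B x) \<in> borel_measurable M"
  by (rule borel_measurable_bilinear[OF bounded_bilinear_matrix_matrix_mult assms])

lemma borel_measurable_transpose [measurable (raw)]:
  fixes A :: "'a \<Rightarrow> real^'n^'m"
  assumes "A \<in> borel_measurable M"
  shows "(\<lambda>x. transpose (A x)) \<in> borel_measurable M"
  using measurable_compose[OF assms borel_measurable_continuous_onI
      [OF linear_continuous_on[OF bounded_linear_transpose]]] .

section \<open>Passage between an interval and the whole line\<close>

lemma square_integrable_indicator:
  assumes "f \<in> square_integrable_on A" "B \<in> sets borel" "B \<subseteq> A"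
  shows "square_integrable lborel (\<lambda>x. indicator B x *\<^sub>R f x)"
proof -
  \<comment> \<open>Measurability of \<open>f\<close> is given only after multiplication by the
    indicator of \<open>A\<close>, so that indicator is inserted first.\<close>
  have eq: "indicator B x *\<^sub>R f x = indicator B x *\<^sub>R (indicator A x *\<^sub>R f x)" for x
    using assms(3) by (auto simp: indicator_def)
  have [measurable]: "(\<lambda>x. indicator A x *\<^sub>R f x) \<in> borel_measurable lborel"
    using assms(1) by (simp add: square_integrable_on_def set_borel_measurable_def)
  have [measurable]: "(\<lambda>x. indicator B x *\<^sub>R f x) \<in> borel_measurable lborel"
    unfolding eq using assms(2) by measurable
  have "integrable lborel (\<lambda>x. (norm (indicator B x *\<^sub>R f x))\<^sup>2)"
  proof (rule Bochner_Integration.integrable_bound)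
    show "integrable lborel (\<lambda>x. indicator A x *\<^sub>R (norm (f x))\<^sup>2)"
      using assms(1) by (simp add: square_integrable_on_def set_integrable_def)
    show "(\<lambda>x. (norm (indicator B x *\<^sub>R f x))\<^sup>2) \<in> borel_measurable lborel" by measurable
  qed (use assms(3) in \<open>auto simp: indicator_def\<close>)
  then show ?thesis
    by (simp add: square_integrable_def)
qed

text \<open>Altering a function at the two endpoints preserves Borel measurability because the
  exceptional set is countable. Almost everywhere equality would not do: \<open>lborel\<close> is
  not complete, so a change on a null set can destroy measurability.\<close>

lemma square_integrable_onI:
  fixes f :: "real \<Rightarrow> 'b::euclidean_space"
  assumes "square_integrable lborel g" "\<And>x. x \<in> {a<..<b} \<Longrightarrow> f x = g x"
  shows "f \<in> square_integrable_on {a..b}"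
proof -
  have [measurable]: "g \<in> borel_measurable lborel"
    using assms(1) by (simp add: square_integrable_def)
  have m: "(\<lambda>x. indicator {a..b} x *\<^sub>R f x) \<in> borel_measurable lborel"
  proof (rule measurable_discrete_difference)
    show "(\<lambda>x. indicator {a<..<b} x *\<^sub>R g x) \<in> borel_measurable lborel" by measurable
    show "countable {a, b}" by simp
  qed (use assms(2) in \<open>auto simp: indicator_def\<close>)
  have AE: "AE x in lborel. x \<noteq> a" "AE x in lborel. x \<noteq> b"
    by (rule AE_lborel_singleton)+
  have "square_integrable lborel (\<lambda>x. indicator {a..b} x *\<^sub>R f x)"
  proof (rule square_integrable_bound[OF assms(1) m, of 1])
    show "AE x in lborel. norm (indicator {a..b} x *\<^sub>R f x) \<le> 1 * norm (g x)"
      using AE by eventually_elim (use assms(2) in \<open>auto simp: indicator_def\<close>)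
  qed
  moreover have "(norm (indicator {a..b} x *\<^sub>R f x))\<^sup>2 = indicator {a..b} x *\<^sub>R (norm (f x))\<^sup>2" for x
    by (simp add: indicator_def)
  ultimately show ?thesis
    by (simp add: square_integrable_on_def square_integrable_def set_borel_measurable_def set_integrable_def)
qed

text \<open>On a set of finite measure the indicator is itself square integrable, and the function
  is its product with that indicator.\<close>

lemma square_integrable_imp_integrable:
  fixes f :: "real \<Rightarrow> 'b::{banach, second_countable_topology}"
  assumes "square_integrable lborel f" "\<And>x. x \<notin> {a<..<b} \<Longrightarrow> f x = 0"
  shows "integrable lborel f"
proof -
  have "square_integrable lborel (indicator {a<..<b} :: real \<Rightarrow> real)"
  proof -
    have "(norm (indicator {a<..<b} x :: real))\<^sup>2 = indicator {a<..<b} x" for x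
      by (simp add: indicator_def)
    moreover have "integrable lborel (indicator {a<..<b} :: real \<Rightarrow> real)"
      by (cases "a \<le> b") (auto intro!: integrable_real_indicator)
    ultimately show ?thesis by (simp add: square_integrable_def)
  qed
  then have "integrable lborel (\<lambda>x. indicator {a<..<b} x *\<^sub>R f x)"
    by (rule square_integrable_bilinear_integrable[OF bounded_bilinear_scaleR _ assms(1)])
  also have "(\<lambda>x. indicator {a<..<b} x *\<^sub>R f x) = f"
    using assms(2) by (auto simp: indicator_def fun_eq_iff)
  finally show ?thesis .
qed

text \<open>With the endpoints moved into a condition, integrals with variable limits become
  parameter integrals over the whole line, whose measurability is then automatic. The order
  \<open>s \<le> t\<close> matters, since reversed limits change the sign.\<close>

lemma interval_integral_eq_if:
  fixes f :: "real \<Rightarrow> 'b::{banach, second_countable_topology}"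
  assumes "s \<le> t" "\<And>\<theta>. s < \<theta> \<Longrightarrow> \<theta> < t \<Longrightarrow> f \<theta> = g \<theta>"
  shows "(LBINT \<theta>=s..t. f \<theta>) = (\<integral>\<theta>. (if s < \<theta> \<and> \<theta> < t then g \<theta> else 0) \<partial>lborel)"
  using assms
  by (auto simp: interval_lebesgue_integral_def set_lebesgue_integral_def indicator_def
      intro!: Bochner_Integration.integral_cong)

lemma integrable_if_interval:
  fixes f :: "real \<Rightarrow> 'b::{banach, second_countable_topology}"
  assumes "integrable lborel f"
  shows "integrable lborel (\<lambda>\<theta>. if s < \<theta> \<and> \<theta> < t then f \<theta> else 0)"
proof -
  have "integrable lborel (\<lambda>\<theta>. indicator {s<..<t} \<theta> *\<^sub>R f \<theta>)"
    by (rule integrable_mult_indicator[OF _ assms]) simp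
  also have "(\<lambda>\<theta>. indicator {s<..<t} \<theta> *\<^sub>R f \<theta>) = (\<lambda>\<theta>. if s < \<theta> \<and> \<theta> < t then f \<theta> else 0)"
    by (auto simp: indicator_def)
  finally show ?thesis .
qed

section \<open>Blocks of a matrix as compressions by coordinate embeddings\<close>

definition block_embedding :: "('i \<Rightarrow> 'k) \<Rightarrow> real^'i^'k" where
  "block_embedding f = (\<chi> r c. if f c = r then 1 else 0)"

lemma blk_eq_compression: "blk f g A = transpose (block_embedding f) ** A ** block_embedding g"
  by (simp add: blk_def block_embedding_def vec_eq_iff matrix_matrix_mult_def transpose_def
      if_distrib if_distribR sum.delta cong: if_cong)

text \<open>When the outer factors live in single block rows, the whole matrix between them
  collapses to one block. Every block in the stated formulas arises this way.\<close>

lemma block_compress: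
  "transpose (block_embedding f) ** A ** (block_embedding g ** Y) = blk f g A ** Y"
  "transpose (block_embedding f ** X) ** A ** (block_embedding g ** Y) = transpose X ** blk f g A ** Y"
  by (simp_all add: blk_eq_compression matrix_transpose_mul matrix_mul_assoc)

lemma matrix_mult_zero_left: "0 ** A = (0 :: real^'p^'m)" for A :: "real^'p^'n"
  by (rule bounded_bilinear.zero_left[OF bounded_bilinear_matrix_matrix_mult])

lemma matrix_mult_zero_right: "A ** 0 = (0 :: real^'p^'m)" for A :: "real^'n^'m"
  by (rule bounded_bilinear.zero_right[OF bounded_bilinear_matrix_matrix_mult])

lemma transpose_zero: "transpose 0 = (0 :: real^'n^'m)"
  by (simp add: transpose_def vec_eq_iff)

section \<open>The block data, truncated and assembled into factors on the line\<close>

locale PI_block_data =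
  fixes a b :: real
    and Z1 :: "real \<Rightarrow> real^'n^'d1"
    and Z2 :: "real \<Rightarrow> real \<Rightarrow> real^'n^'d2"
    and T :: "real^('m::finite + 'd1::finite + 'd2::finite + 'd2)^('m + 'd1 + 'd2 + 'd2)"
    and P :: "real^'m^'m"
    and Q :: "real \<Rightarrow> real^'n^'m"
    and S :: "real \<Rightarrow> real^'n^'n"
    and R1 R2 :: "real \<Rightarrow> real \<Rightarrow> real^'n^'n"
  assumes ab: "a \<le> b"
    and Z1_measurable: "set_borel_measurable lborel {a..b} Z1"
    and Z1_bounded: "bounded (Z1 ` {a..b})"
    and Z2_square_integrable: "(\<lambda>(s, \<eta>). Z2 s \<eta>) \<in> square_integrable_on ({a..b} \<times> {a..b})"
    and T_psd: "psd_matrix T"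
    and P_eq: "P = blk ix1 ix1 T"
    and Q_eq: "\<And>s. s \<in> {a..b} \<Longrightarrow>
      Q s = blk ix1 ix2 T ** Z1 s
            + (LBINT \<eta>=s..b. blk ix1 ix3 T ** Z2 \<eta> s)
            + (LBINT \<eta>=a..s. blk ix1 ix4 T ** Z2 \<eta> s)"
    and S_eq: "\<And>s. s \<in> {a..b} \<Longrightarrow> S s = transpose (Z1 s) ** blk ix2 ix2 T ** Z1 s"
    and R1_eq: "\<And>s \<eta>. s \<in> {a..b} \<Longrightarrow> \<eta> \<in> {a..b} \<Longrightarrow>
      R1 s \<eta> = transpose (Z1 s) ** blk ix2 ix3 T ** Z2 s \<eta>
               + transpose (Z2 \<eta> s) ** blk ix4 ix2 T ** Z1 \<eta>
               + (LBINT \<theta>=s..b. transpose (Z2 \<theta> s) ** blk ix3 ix3 T ** Z2 \<theta> \<eta>)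
               + (LBINT \<theta>=\<eta>..s. transpose (Z2 \<theta> s) ** blk ix4 ix3 T ** Z2 \<theta> \<eta>)
               + (LBINT \<theta>=a..\<eta>. transpose (Z2 \<theta> s) ** blk ix4 ix4 T ** Z2 \<theta> \<eta>)"
    and R2_eq: "\<And>s \<eta>. s \<in> {a..b} \<Longrightarrow> \<eta> \<in> {a..b} \<Longrightarrow>
      R2 s \<eta> = transpose (Z1 s) ** blk ix2 ix4 T ** Z2 s \<eta>
               + transpose (Z2 \<eta> s) ** blk ix3 ix2 T ** Z1 \<eta>
               + (LBINT \<theta>=\<eta>..b. transpose (Z2 \<theta> s) ** blk ix3 ix3 T ** Z2 \<theta> \<eta>)
               + (LBINT \<theta>=s..\<eta>. transpose (Z2 \<theta> s) ** blk ix3 ix4 T ** Z2 \<theta> \<eta>)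
               + (LBINT \<theta>=a..s. transpose (Z2 \<theta> s) ** blk ix4 ix4 T ** Z2 \<theta> \<eta>)"
begin

text \<open>Truncation is to the open interval because \<open>LBINT s=a..b\<close> integrates over \<open>{a<..<b}\<close>.\<close>

definition Y1 :: "real \<Rightarrow> real^'n^'d1" where
  "Y1 s = indicator {a<..<b} s *\<^sub>R Z1 s"

definition Y2 :: "real \<Rightarrow> real \<Rightarrow> real^'n^'d2" where
  "Y2 s \<eta> = indicator ({a<..<b} \<times> {a<..<b}) (s, \<eta>) *\<^sub>R Z2 s \<eta>"

text \<open>The indicator makes a constant block square integrable on the line; integrating it is
  the source of the factor \<open>b - a\<close> in front of \<open>P\<close>.\<close>

definition KA :: "real \<Rightarrow> real^'m^('m + 'd1 + 'd2 + 'd2)" where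
  "KA s = indicator {a<..<b} s *\<^sub>R block_embedding ix1"

definition KB :: "real \<Rightarrow> real^'n^('m + 'd1 + 'd2 + 'd2)" where
  "KB s = block_embedding ix2 ** Y1 s"

text \<open>With the value 0 on the diagonal, the products below agree with the strict conditionals
  at every point, so no almost everywhere argument is needed there.\<close>

definition KG :: "real \<Rightarrow> real \<Rightarrow> real^'n^('m + 'd1 + 'd2 + 'd2)" where
  "KG s \<eta> = (if \<eta> < s then block_embedding ix3 ** Y2 s \<eta>
     else if s < \<eta> then block_embedding ix4 ** Y2 s \<eta> else 0)"

lemma Y1_measurable [measurable]: "Y1 \<in> borel_measurable borel"
proof -
  have "(\<lambda>s. indicator {a<..<b} s *\<^sub>R (indicator {a..b} s *\<^sub>R Z1 s)) \<in> borel_measurable borel"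
    using Z1_measurable unfolding set_borel_measurable_def by measurable
  also have "(\<lambda>s. indicator {a<..<b} s *\<^sub>R (indicator {a..b} s *\<^sub>R Z1 s)) = Y1"
    by (auto simp: Y1_def indicator_def fun_eq_iff)
  finally show ?thesis .
qed

lemma Y1_bounded: "bounded (range Y1)"
proof (rule bounded_subset)
  show "bounded (insert 0 (Z1 ` {a..b}))" using Z1_bounded by simp
  show "range Y1 \<subseteq> insert 0 (Z1 ` {a..b})" by (auto simp: Y1_def indicator_def)
qed

lemma Y2_square_integrable: "square_integrable (lborel \<Otimes>\<^sub>M lborel) (case_prod Y2)"
proof -
  have "square_integrable lborel (\<lambda>p. indicator ({a<..<b} \<times> {a<..<b}) p *\<^sub>R (case p of (s, \<eta>) \<Rightarrow> Z2 s \<eta>))"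
    by (rule square_integrable_indicator[OF Z2_square_integrable])
      (auto intro!: borel_open open_Times)
  also have "(\<lambda>p. indicator ({a<..<b} \<times> {a<..<b}) p *\<^sub>R (case p of (s, \<eta>) \<Rightarrow> Z2 s \<eta>)) = case_prod Y2"
    by (auto simp: Y2_def fun_eq_iff)
  finally show ?thesis unfolding lborel_prod .
qed

lemma Y2_measurable [measurable (raw)]:
  assumes "f \<in> borel_measurable M" "g \<in> borel_measurable M"
  shows "(\<lambda>x. Y2 (f x) (g x)) \<in> borel_measurable M"
proof -
  have "case_prod Y2 \<in> borel_measurable (borel \<Otimes>\<^sub>M borel)"
    using Y2_square_integrable by (simp add: square_integrable_def cong: measurable_cong_sets sets_pair_measure_cong)
  from measurable_compose[OF measurable_Pair[OF assms] this] show ?thesis by simp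
qed

lemma KG_square_integrable: "square_integrable (lborel \<Otimes>\<^sub>M lborel) (case_prod KG)"
proof -
  have l: "bounded_linear (\<lambda>X. block_embedding f ** X)" for f :: "'i::finite \<Rightarrow> 'm + 'd1 + 'd2 + 'd2"
    by (rule bounded_bilinear.bounded_linear_right[OF bounded_bilinear_matrix_matrix_mult])
  have 1: "square_integrable (lborel \<Otimes>\<^sub>M lborel) (\<lambda>p. indicator D p *\<^sub>R (block_embedding f ** case_prod Y2 p))"
    if [measurable]: "D \<in> sets (lborel \<Otimes>\<^sub>M lborel)" for D and f :: "'d2 \<Rightarrow> 'm + 'd1 + 'd2 + 'd2"
  proof (rule square_integrable_bounded_mult[OF bounded_bilinear_scaleR])
    show "square_integrable (lborel \<Otimes>\<^sub>M lborel) (\<lambda>p. block_embedding f ** case_prod Y2 p)"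
      by (rule square_integrable_linear[OF l Y2_square_integrable])
    show "bounded (range (indicator D :: _ \<Rightarrow> real))"
      by (rule boundedI[of _ 1]) (auto simp: indicator_def)
  qed measurable
  have D: "{(s::real, \<eta>). \<eta> < s} \<in> sets (lborel \<Otimes>\<^sub>M lborel)"
    "{(s::real, \<eta>). s < \<eta>} \<in> sets (lborel \<Otimes>\<^sub>M lborel)"
    unfolding lborel_prod by (auto intro!: borel_open open_Collect_less continuous_intros simp: split_def)
  have "square_integrable (lborel \<Otimes>\<^sub>M lborel) (\<lambda>p. indicator {(s, \<eta>). \<eta> < s} p *\<^sub>R (block_embedding ix3 ** case_prod Y2 p)
      + indicator {(s, \<eta>). s < \<eta>} p *\<^sub>R (block_embedding ix4 ** case_prod Y2 p)
      :: real^'n^('m + 'd1 + 'd2 + 'd2))"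
    by (rule square_integrable_add[OF 1[OF D(1)] 1[OF D(2)]])
  also have "(\<lambda>p. indicator {(s, \<eta>). \<eta> < s} p *\<^sub>R (block_embedding ix3 ** case_prod Y2 p)
      + indicator {(s, \<eta>). s < \<eta>} p *\<^sub>R (block_embedding ix4 ** case_prod Y2 p)) = case_prod KG"
    by (auto simp: KG_def fun_eq_iff indicator_def)
  finally show ?thesis .
qed

sublocale F: PI_factorisation lborel KA KB KG T
proof
  show "square_integrable lborel KA"
  proof -
    have "KA \<in> borel_measurable lborel" unfolding KA_def by measurable
    moreover have "(norm (KA s))\<^sup>2 = indicator {a<..<b} s *\<^sub>R (norm (block_embedding ix1 :: real^'m^('m + 'd1 + 'd2 + 'd2)))\<^sup>2" for s
      by (simp add: KA_def indicator_def)
    ultimately show ?thesis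
      using ab by (simp add: square_integrable_def)
  qed
  show "KB \<in> borel_measurable lborel" unfolding KB_def by measurable
  have "bounded ((\<lambda>X. block_embedding ix2 ** X) ` range Y1)"
    by (rule bounded_linear_image[OF Y1_bounded])
      (rule bounded_bilinear.bounded_linear_right[OF bounded_bilinear_matrix_matrix_mult])
  then show "bounded (range KB)" by (simp add: KB_def image_image)
  show "square_integrable (lborel \<Otimes>\<^sub>M lborel) (case_prod KG)" by (rule KG_square_integrable)
  show "transpose T = T" "0 \<le> v \<bullet> (T *v v)" for v using T_psd by (auto simp: psd_matrix_def)
qed

text \<open>The kernels \<open>QY\<close>, \<open>RY1\<close>, \<open>RY2\<close> agree with the given ones at every point of the open
  interval, which is what Borel measurability of the image needs. They agree with \<open>F.Qk\<close> and \<open>F.Rk\<close>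
  only where the slices \<open>Z2(-, s)\<close> are square integrable, hence almost everywhere: elsewhere a
  non-integrable integrand makes one side the junk value 0.\<close>

definition QY :: "real \<Rightarrow> real^'n^'m" where
  "QY s = blk ix1 ix2 T ** Y1 s
     + (\<integral>\<theta>. (if s < \<theta> \<and> \<theta> < b then blk ix1 ix3 T ** Y2 \<theta> s else 0) \<partial>lborel)
     + (\<integral>\<theta>. (if a < \<theta> \<and> \<theta> < s then blk ix1 ix4 T ** Y2 \<theta> s else 0) \<partial>lborel)"

definition RY1 :: "real \<Rightarrow> real \<Rightarrow> real^'n^'n" where
  "RY1 s \<eta> = transpose (Y1 s) ** blk ix2 ix3 T ** Y2 s \<eta> + transpose (Y2 \<eta> s) ** blk ix4 ix2 T ** Y1 \<eta>
     + (\<integral>\<theta>. (if s < \<theta> \<and> \<theta> < b then transpose (Y2 \<theta> s) ** blk ix3 ix3 T ** Y2 \<theta> \<eta> else 0) \<partial>lborel)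
     + (\<integral>\<theta>. (if \<eta> < \<theta> \<and> \<theta> < s then transpose (Y2 \<theta> s) ** blk ix4 ix3 T ** Y2 \<theta> \<eta> else 0) \<partial>lborel)
     + (\<integral>\<theta>. (if a < \<theta> \<and> \<theta> < \<eta> then transpose (Y2 \<theta> s) ** blk ix4 ix4 T ** Y2 \<theta> \<eta> else 0) \<partial>lborel)"

definition RY2 :: "real \<Rightarrow> real \<Rightarrow> real^'n^'n" where
  "RY2 s \<eta> = transpose (Y1 s) ** blk ix2 ix4 T ** Y2 s \<eta> + transpose (Y2 \<eta> s) ** blk ix3 ix2 T ** Y1 \<eta>
     + (\<integral>\<theta>. (if \<eta> < \<theta> \<and> \<theta> < b then transpose (Y2 \<theta> s) ** blk ix3 ix3 T ** Y2 \<theta> \<eta> else 0) \<partial>lborel)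
     + (\<integral>\<theta>. (if s < \<theta> \<and> \<theta> < \<eta> then transpose (Y2 \<theta> s) ** blk ix3 ix4 T ** Y2 \<theta> \<eta> else 0) \<partial>lborel)
     + (\<integral>\<theta>. (if a < \<theta> \<and> \<theta> < s then transpose (Y2 \<theta> s) ** blk ix4 ix4 T ** Y2 \<theta> \<eta> else 0) \<partial>lborel)"

lemma QY_measurable [measurable]: "QY \<in> borel_measurable borel"
  unfolding QY_def by measurable

lemma RY_measurable [measurable (raw)]:
  assumes [measurable]: "f \<in> borel_measurable M" "g \<in> borel_measurable M"
  shows "(\<lambda>x. RY1 (f x) (g x)) \<in> borel_measurable M" "(\<lambda>x. RY2 (f x) (g x)) \<in> borel_measurable M"
  unfolding RY1_def RY2_def by measurable

section \<open>Agreement of the given, the pointwise and the abstract kernels\<close>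

lemma Y1_eq: "s \<in> {a<..<b} \<Longrightarrow> Y1 s = Z1 s"
  by (simp add: Y1_def)

lemma Y2_eq: "s \<in> {a<..<b} \<Longrightarrow> \<eta> \<in> {a<..<b} \<Longrightarrow> Y2 s \<eta> = Z2 s \<eta>"
  by (simp add: Y2_def)

lemma Q_eq_QY: "Q s = QY s" if s: "s \<in> {a<..<b}"
proof -
  have 1: "(LBINT \<theta>=s..b. blk ix1 ix3 T ** Z2 \<theta> s)
      = (\<integral>\<theta>. (if s < \<theta> \<and> \<theta> < b then blk ix1 ix3 T ** Y2 \<theta> s else 0) \<partial>lborel)"
    by (rule interval_integral_eq_if) (use s in \<open>auto simp: Y2_eq\<close>)
  have 2: "(LBINT \<theta>=a..s. blk ix1 ix4 T ** Z2 \<theta> s)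
      = (\<integral>\<theta>. (if a < \<theta> \<and> \<theta> < s then blk ix1 ix4 T ** Y2 \<theta> s else 0) \<partial>lborel)"
    by (rule interval_integral_eq_if) (use s in \<open>auto simp: Y2_eq\<close>)
  show ?thesis
    using s by (simp add: Q_eq QY_def 1 2 Y1_eq)
qed

text \<open>Below the diagonal all three integrals have increasing limits, as the conditionals in
  \<open>RY1\<close> require. This is the triangle over which the operator integrates
  \<open>R1\<close>.\<close>

lemma R1_eq_RY1: "R1 s \<eta> = RY1 s \<eta>" if h: "a < \<eta>" "\<eta> < s" "s < b"
proof -
  have 1: "(LBINT \<theta>=s..b. transpose (Z2 \<theta> s) ** blk ix3 ix3 T ** Z2 \<theta> \<eta>)
      = (\<integral>\<theta>. (if s < \<theta> \<and> \<theta> < b then transpose (Y2 \<theta> s) ** blk ix3 ix3 T ** Y2 \<theta> \<eta> else 0) \<partial>lborel)"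
    by (rule interval_integral_eq_if) (use h in \<open>auto simp: Y2_eq\<close>)
  have 2: "(LBINT \<theta>=\<eta>..s. transpose (Z2 \<theta> s) ** blk ix4 ix3 T ** Z2 \<theta> \<eta>)
      = (\<integral>\<theta>. (if \<eta> < \<theta> \<and> \<theta> < s then transpose (Y2 \<theta> s) ** blk ix4 ix3 T ** Y2 \<theta> \<eta> else 0) \<partial>lborel)"
    by (rule interval_integral_eq_if) (use h in \<open>auto simp: Y2_eq\<close>)
  have 3: "(LBINT \<theta>=a..\<eta>. transpose (Z2 \<theta> s) ** blk ix4 ix4 T ** Z2 \<theta> \<eta>)
      = (\<integral>\<theta>. (if a < \<theta> \<and> \<theta> < \<eta> then transpose (Y2 \<theta> s) ** blk ix4 ix4 T ** Y2 \<theta> \<eta> else 0) \<partial>lborel)"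
    by (rule interval_integral_eq_if) (use h in \<open>auto simp: Y2_eq\<close>)
  show ?thesis
    using h by (simp add: R1_eq RY1_def 1 2 3 Y1_eq Y2_eq)
qed

lemma R2_eq_RY2: "R2 s \<eta> = RY2 s \<eta>" if h: "a < s" "s < \<eta>" "\<eta> < b"
proof -
  have 1: "(LBINT \<theta>=\<eta>..b. transpose (Z2 \<theta> s) ** blk ix3 ix3 T ** Z2 \<theta> \<eta>)
      = (\<integral>\<theta>. (if \<eta> < \<theta> \<and> \<theta> < b then transpose (Y2 \<theta> s) ** blk ix3 ix3 T ** Y2 \<theta> \<eta> else 0) \<partial>lborel)"
    by (rule interval_integral_eq_if) (use h in \<open>auto simp: Y2_eq\<close>)
  have 2: "(LBINT \<theta>=s..\<eta>. transpose (Z2 \<theta> s) ** blk ix3 ix4 T ** Z2 \<theta> \<eta>)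
      = (\<integral>\<theta>. (if s < \<theta> \<and> \<theta> < \<eta> then transpose (Y2 \<theta> s) ** blk ix3 ix4 T ** Y2 \<theta> \<eta> else 0) \<partial>lborel)"
    by (rule interval_integral_eq_if) (use h in \<open>auto simp: Y2_eq\<close>)
  have 3: "(LBINT \<theta>=a..s. transpose (Z2 \<theta> s) ** blk ix4 ix4 T ** Z2 \<theta> \<eta>)
      = (\<integral>\<theta>. (if a < \<theta> \<and> \<theta> < s then transpose (Y2 \<theta> s) ** blk ix4 ix4 T ** Y2 \<theta> \<eta> else 0) \<partial>lborel)"
    by (rule interval_integral_eq_if) (use h in \<open>auto simp: Y2_eq\<close>)
  show ?thesis
    using h by (simp add: R2_eq RY2_def 1 2 3 Y1_eq Y2_eq)
qed

lemma AE_slice: "AE s in lborel. square_integrable lborel (\<lambda>\<theta>. Y2 \<theta> s)"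
  by (rule lborel_pair.AE_square_integrable_snd[OF Y2_square_integrable])

lemma Pk_eq: "F.Pk = (b - a) *\<^sub>R P"
proof -
  have "transpose (KA \<theta>) ** T ** KA \<theta> = indicator {a<..<b} \<theta> *\<^sub>R P" for \<theta>
    by (simp add: KA_def P_eq blk_eq_compression indicator_def matrix_mult_zero_right)
  then show ?thesis
    using ab by (simp add: F.Pk_def)
qed

text \<open>The point \<open>s\<close> cuts the interval in two: beyond it
  \<open>KG \<theta> s\<close> lies in the third block, before it in the fourth. Square
  integrability of the slice allows the integral of the sum to be split.\<close>

lemma QY_eq_Qk: "QY s = F.Qk s"
  if s: "s \<in> {a<..<b}" and sq: "square_integrable lborel (\<lambda>\<theta>. Y2 \<theta> s)"
proof -
  have Y: "integrable lborel (\<lambda>\<theta>. blk ix1 f T ** Y2 \<theta> s)" for f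
    by (rule integrable_bounded_linear[OF bounded_bilinear.bounded_linear_right
          [OF bounded_bilinear_matrix_matrix_mult] square_integrable_imp_integrable[OF sq, of a b]])
      (auto simp: Y2_def indicator_def)
  have "transpose (KA \<theta>) ** T ** KG \<theta> s
      = (if s < \<theta> \<and> \<theta> < b then blk ix1 ix3 T ** Y2 \<theta> s else 0)
        + (if a < \<theta> \<and> \<theta> < s then blk ix1 ix4 T ** Y2 \<theta> s else 0)" for \<theta>
    using s by (auto simp: KA_def KG_def indicator_def block_compress matrix_mult_zero_left
        matrix_mult_zero_right transpose_zero)
  then have "(\<integral>\<theta>. transpose (KA \<theta>) ** T ** KG \<theta> s \<partial>lborel)
      = (\<integral>\<theta>. (if s < \<theta> \<and> \<theta> < b then blk ix1 ix3 T ** Y2 \<theta> s else 0) \<partial>lborel)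
        + (\<integral>\<theta>. (if a < \<theta> \<and> \<theta> < s then blk ix1 ix4 T ** Y2 \<theta> s else 0) \<partial>lborel)"
    by (simp add: integrable_if_interval[OF Y])
  moreover have "transpose (KA s) ** T ** KB s = blk ix1 ix2 T ** Y1 s"
    using s by (simp add: KA_def KB_def block_compress)
  ultimately show ?thesis by (simp add: F.Qk_def QY_def)
qed

lemma integrable_block_product:
  assumes "square_integrable lborel (\<lambda>\<theta>. Y2 \<theta> s)" "square_integrable lborel (\<lambda>\<theta>. Y2 \<theta> \<eta>)"
  shows "integrable lborel (\<lambda>\<theta>. if c < \<theta> \<and> \<theta> < d then transpose (Y2 \<theta> s) ** D ** Y2 \<theta> \<eta> else 0)"
  by (intro integrable_if_interval
      square_integrable_bilinear_integrable[OF bounded_bilinear_transpose_mult(2) assms])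

text \<open>The points \<open>s\<close> and \<open>\<eta>\<close> cut the interval into three
  pieces. On each of them \<open>KG \<theta> s\<close> and \<open>KG \<theta> \<eta>\<close> lie in
  fixed blocks, which select one block of \<open>T\<close> and one of the three integrals.\<close>

lemma RY_eq_Rk:
  assumes s: "s \<in> {a<..<b}" and \<eta>: "\<eta> \<in> {a<..<b}"
    and sq: "square_integrable lborel (\<lambda>\<theta>. Y2 \<theta> s)" "square_integrable lborel (\<lambda>\<theta>. Y2 \<theta> \<eta>)"
  shows "\<eta> < s \<Longrightarrow> RY1 s \<eta> = F.Rk s \<eta>" "s < \<eta> \<Longrightarrow> RY2 s \<eta> = F.Rk s \<eta>"
proof -
  note I = integrable_block_product[OF sq]
  have Y0: "Y2 \<theta> t = 0" if "\<theta> \<le> a \<or> b \<le> \<theta>" for \<theta> t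
    using that by (auto simp: Y2_def indicator_def)
  note simps = KG_def block_compress Y0 matrix_mult_zero_left matrix_mult_zero_right transpose_zero
  have int3: "(\<integral>\<theta>. f \<theta> \<partial>lborel) = (\<integral>\<theta>. f1 \<theta> \<partial>lborel) + (\<integral>\<theta>. f2 \<theta> \<partial>lborel) + (\<integral>\<theta>. f3 \<theta> \<partial>lborel)"
    if "\<And>\<theta>. f \<theta> = f1 \<theta> + f2 \<theta> + f3 \<theta>" "integrable lborel f1" "integrable lborel f2" "integrable lborel f3"
    for f f1 f2 f3 :: "real \<Rightarrow> real^'n^'n"
    unfolding that(1) using that(2-) by simp
  show "RY1 s \<eta> = F.Rk s \<eta>" if less: "\<eta> < s"
  proof -
    have "transpose (KG \<theta> s) ** T ** KG \<theta> \<eta>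
        = (if s < \<theta> \<and> \<theta> < b then transpose (Y2 \<theta> s) ** blk ix3 ix3 T ** Y2 \<theta> \<eta> else 0)
          + (if \<eta> < \<theta> \<and> \<theta> < s then transpose (Y2 \<theta> s) ** blk ix4 ix3 T ** Y2 \<theta> \<eta> else 0)
          + (if a < \<theta> \<and> \<theta> < \<eta> then transpose (Y2 \<theta> s) ** blk ix4 ix4 T ** Y2 \<theta> \<eta> else 0)" for \<theta>
    proof -
      \<comment> \<open>Outside the interval \<open>Y2\<close> vanishes, and at
        \<open>\<theta> = \<eta>\<close> and \<open>\<theta> = s\<close> one factor is a diagonal
        value of \<open>KG\<close>, hence 0.\<close>
      consider "\<theta> \<le> a" | "a < \<theta>" "\<theta> < \<eta>" | "\<theta> = \<eta>" | "\<eta> < \<theta>" "\<theta> < s" | "\<theta> = s"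
        | "s < \<theta>" "\<theta> < b" | "b \<le> \<theta>" by linarith
      then show ?thesis by cases (use s \<eta> less in \<open>simp_all add: simps\<close>)
    qed
    note J = int3[OF this I I I]
    show ?thesis
      unfolding F.Rk_def RY1_def J using less by (simp add: KB_def KG_def block_compress)
  qed
  show "RY2 s \<eta> = F.Rk s \<eta>" if less: "s < \<eta>"
  proof -
    have "transpose (KG \<theta> s) ** T ** KG \<theta> \<eta>
        = (if \<eta> < \<theta> \<and> \<theta> < b then transpose (Y2 \<theta> s) ** blk ix3 ix3 T ** Y2 \<theta> \<eta> else 0)
          + (if s < \<theta> \<and> \<theta> < \<eta> then transpose (Y2 \<theta> s) ** blk ix3 ix4 T ** Y2 \<theta> \<eta> else 0)
          + (if a < \<theta> \<and> \<theta> < s then transpose (Y2 \<theta> s) ** blk ix4 ix4 T ** Y2 \<theta> \<eta> else 0)" for \<theta>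
    proof -
      consider "\<theta> \<le> a" | "a < \<theta>" "\<theta> < s" | "\<theta> = s" | "s < \<theta>" "\<theta> < \<eta>" | "\<theta> = \<eta>"
        | "\<eta> < \<theta>" "\<theta> < b" | "b \<le> \<theta>" by linarith
      then show ?thesis by cases (use s \<eta> less in \<open>simp_all add: simps\<close>)
    qed
    note J = int3[OF this I I I]
    show ?thesis
      unfolding F.Rk_def RY2_def J using less by (simp add: KB_def KG_def block_compress)
  qed
qed

section \<open>The operator at a fixed element of the space\<close>

context
  fixes x :: "real^'m" and z :: "real \<Rightarrow> real^'n"
  assumes z: "z \<in> square_integrable_on {a..b}"
begin

definition zI :: "real \<Rightarrow> real^'n" where
  "zI s = indicator {a<..<b} s *\<^sub>R z s"

lemma zI_square_integrable: "square_integrable lborel zI"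
  unfolding zI_def by (rule square_integrable_indicator[OF z]) auto

lemma zI_measurable [measurable]: "zI \<in> borel_measurable borel"
  using zI_square_integrable by (simp add: square_integrable_def)

text \<open>An intermediary: Borel measurable and equal to the function component at every interior
  point, but equal to \<open>F.W\<close> only almost everywhere on the interval.\<close>

definition WY :: "real \<Rightarrow> real^'n" where
  "WY s = transpose (QY s) *v x + (transpose (Y1 s) ** blk ix2 ix2 T ** Y1 s) *v zI s
     + (\<integral>\<eta>. (if a < \<eta> \<and> \<eta> < s then RY1 s \<eta> *v zI \<eta> else 0) \<partial>lborel)
     + (\<integral>\<eta>. (if s < \<eta> \<and> \<eta> < b then RY2 s \<eta> *v zI \<eta> else 0) \<partial>lborel)"

lemma WY_measurable: "WY \<in> borel_measurable borel"
  unfolding WY_def by measurable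

lemma PI_operator_snd_eq:
  assumes "s \<in> {a<..<b}"
  shows "snd (PI_operator a b P' Q (\<lambda>s. transpose (Q s)) S R1 R2 (x, z)) s = WY s"
proof -
  have 1: "(LBINT \<eta>=a..s. R1 s \<eta> *v z \<eta>)
      = (\<integral>\<eta>. (if a < \<eta> \<and> \<eta> < s then RY1 s \<eta> *v zI \<eta> else 0) \<partial>lborel)"
    by (rule interval_integral_eq_if) (use assms in \<open>auto simp: R1_eq_RY1 zI_def\<close>)
  have 2: "(LBINT \<eta>=s..b. R2 s \<eta> *v z \<eta>)
      = (\<integral>\<eta>. (if s < \<eta> \<and> \<eta> < b then RY2 s \<eta> *v zI \<eta> else 0) \<partial>lborel)"
    by (rule interval_integral_eq_if) (use assms in \<open>auto simp: R2_eq_RY2 zI_def\<close>)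
  show ?thesis
    using assms by (simp add: PI_operator_def WY_def 1 2 Q_eq_QY S_eq Y1_eq zI_def)
qed

lemma PI_operator_fst_eq:
  "fst (PI_operator a b P' Q (\<lambda>s. transpose (Q s)) S R1 R2 (x, z)) = P' *v x + (\<integral>s. F.Qk s *v zI s \<partial>lborel)"
proof -
  have "(LBINT s=a..b. Q s *v z s) = (\<integral>s. (if a < s \<and> s < b then QY s *v zI s else 0) \<partial>lborel)"
    by (rule interval_integral_eq_if) (use ab in \<open>auto simp: Q_eq_QY zI_def\<close>)
  also have "\<dots> = (\<integral>s. F.Qk s *v zI s \<partial>lborel)"
  proof (rule integral_cong_AE)
    show "(\<lambda>s. F.Qk s *v zI s) \<in> borel_measurable lborel"
      using F.integral_A_V(1)[OF zI_square_integrable] by (rule borel_measurable_integrable)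
    show "AE s in lborel. (if a < s \<and> s < b then QY s *v zI s else 0) = F.Qk s *v zI s"
      using AE_slice by eventually_elim (auto simp: QY_eq_Qk zI_def indicator_def)
  qed measurable
  finally show ?thesis by (simp add: PI_operator_def)
qed

text \<open>Two layers of exceptional sets occur. For almost every \<open>s\<close> the slice
  through \<open>s\<close> is square integrable, and for such \<open>s\<close> the kernels agree at
  almost every \<open>\<eta>\<close>, which suffices under the integral.\<close>

lemma AE_WY_eq: "AE s in lborel. s \<in> {a<..<b} \<longrightarrow> WY s = F.W x zI s"
  using F.AE_W[OF zI_square_integrable, of x] AE_slice
proof eventually_elim
  case (elim s)
  show ?case
  proof
    assume s: "s \<in> {a<..<b}"
    have int: "integrable lborel (\<lambda>\<eta>. F.Rk s \<eta> *v zI \<eta>)" using elim(1) by blast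
    note m = borel_measurable_integrable[OF int]
    have 1: "(\<integral>\<eta>. (if a < \<eta> \<and> \<eta> < s then RY1 s \<eta> *v zI \<eta> else 0) \<partial>lborel)
        = (\<integral>\<eta>. (if a < \<eta> \<and> \<eta> < s then F.Rk s \<eta> *v zI \<eta> else 0) \<partial>lborel)"
    proof (rule integral_cong_AE)
      show "AE \<eta> in lborel. (if a < \<eta> \<and> \<eta> < s then RY1 s \<eta> *v zI \<eta> else 0)
          = (if a < \<eta> \<and> \<eta> < s then F.Rk s \<eta> *v zI \<eta> else 0)"
        using AE_slice by eventually_elim (use s elim(2) in \<open>auto simp: RY_eq_Rk(1)\<close>)
      show "(\<lambda>\<eta>. if a < \<eta> \<and> \<eta> < s then F.Rk s \<eta> *v zI \<eta> else 0) \<in> borel_measurable lborel"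
        using m by measurable
    qed measurable
    have 2: "(\<integral>\<eta>. (if s < \<eta> \<and> \<eta> < b then RY2 s \<eta> *v zI \<eta> else 0) \<partial>lborel)
        = (\<integral>\<eta>. (if s < \<eta> \<and> \<eta> < b then F.Rk s \<eta> *v zI \<eta> else 0) \<partial>lborel)"
    proof (rule integral_cong_AE)
      show "AE \<eta> in lborel. (if s < \<eta> \<and> \<eta> < b then RY2 s \<eta> *v zI \<eta> else 0)
          = (if s < \<eta> \<and> \<eta> < b then F.Rk s \<eta> *v zI \<eta> else 0)"
        using AE_slice by eventually_elim (use s elim(2) in \<open>auto simp: RY_eq_Rk(2)\<close>)
      show "(\<lambda>\<eta>. if s < \<eta> \<and> \<eta> < b then F.Rk s \<eta> *v zI \<eta> else 0) \<in> borel_measurable lborel"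
        using m by measurable
    qed measurable
    \<comment> \<open>The split at \<open>\<eta> = s\<close> loses only a single point, and outside
      the interval \<open>zI\<close> vanishes.\<close>
    have "(\<integral>\<eta>. F.Rk s \<eta> *v zI \<eta> \<partial>lborel)
        = (\<integral>\<eta>. (if a < \<eta> \<and> \<eta> < s then F.Rk s \<eta> *v zI \<eta> else 0)
            + (if s < \<eta> \<and> \<eta> < b then F.Rk s \<eta> *v zI \<eta> else 0) \<partial>lborel)"
    proof (rule integral_cong_AE[OF m])
      show "AE \<eta> in lborel. F.Rk s \<eta> *v zI \<eta>
          = (if a < \<eta> \<and> \<eta> < s then F.Rk s \<eta> *v zI \<eta> else 0)
            + (if s < \<eta> \<and> \<eta> < b then F.Rk s \<eta> *v zI \<eta> else 0)"
        using AE_lborel_singleton[of s]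
        by eventually_elim (use s in \<open>auto simp: zI_def indicator_def\<close>)
    qed (intro borel_measurable_integrable Bochner_Integration.integrable_add integrable_if_interval int)
    also have "\<dots> = (\<integral>\<eta>. (if a < \<eta> \<and> \<eta> < s then F.Rk s \<eta> *v zI \<eta> else 0) \<partial>lborel)
        + (\<integral>\<eta>. (if s < \<eta> \<and> \<eta> < b then F.Rk s \<eta> *v zI \<eta> else 0) \<partial>lborel)"
      by (intro Bochner_Integration.integral_add integrable_if_interval int)
    finally have 3: "(\<integral>\<eta>. F.Rk s \<eta> *v zI \<eta> \<partial>lborel) = \<dots>" .
    show "WY s = F.W x zI s"
      using elim(1) unfolding WY_def 1 2 QY_eq_Qk[OF s elim(2)]
      by (simp add: 3 KB_def block_compress add.assoc)
  qed
qed

text \<open>Measurability comes from the pointwise equality with \<open>WY\<close>, the norm bound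
  from the almost everywhere equality with \<open>F.W\<close>. \<open>P'\<close> is arbitrary, so
  both normalisations are covered at once.\<close>

lemma PI_operator_in_RL2:
  "PI_operator a b P' Q (\<lambda>s. transpose (Q s)) S R1 R2 (x, z) \<in> RL2 a b"
proof -
  have WY0: "square_integrable lborel (\<lambda>s. indicator {a<..<b} s *\<^sub>R WY s)"
  proof (rule square_integrable_bound[OF F.square_integrable_W[OF zI_square_integrable, of x], of _ 1])
    show "(\<lambda>s. indicator {a<..<b} s *\<^sub>R WY s) \<in> borel_measurable lborel"
      using WY_measurable by measurable
    show "AE s in lborel. norm (indicator {a<..<b} s *\<^sub>R WY s) \<le> 1 * norm (F.W x zI s)"
      using AE_WY_eq by eventually_elim (auto simp: indicator_def)
  qed
  have "snd (PI_operator a b P' Q (\<lambda>s. transpose (Q s)) S R1 R2 (x, z)) \<in> square_integrable_on {a..b}"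
    by (rule square_integrable_onI[OF WY0]) (simp add: PI_operator_snd_eq)
  then show ?thesis
    by (simp add: RL2_def mem_Times_iff)
qed

lemma RL2_inner_PI_operator:
  "RL2_inner a b (x, z) (PI_operator a b P' Q (\<lambda>s. transpose (Q s)) S R1 R2 (x, z))
    = x \<bullet> (P' *v x + (\<integral>s. F.Qk s *v zI s \<partial>lborel)) + (\<integral>s. zI s \<bullet> F.W x zI s \<partial>lborel)"
proof -
  have "(LBINT s=a..b. z s \<bullet> snd (PI_operator a b P' Q (\<lambda>s. transpose (Q s)) S R1 R2 (x, z)) s)
      = (\<integral>s. (if a < s \<and> s < b then zI s \<bullet> WY s else 0) \<partial>lborel)"
    by (rule interval_integral_eq_if) (use ab in \<open>auto simp: PI_operator_snd_eq zI_def\<close>)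
  also have "\<dots> = (\<integral>s. zI s \<bullet> F.W x zI s \<partial>lborel)"
  proof (rule integral_cong_AE)
    show "(\<lambda>s. if a < s \<and> s < b then zI s \<bullet> WY s else 0) \<in> borel_measurable lborel"
      using WY_measurable by measurable
    show "(\<lambda>s. zI s \<bullet> F.W x zI s) \<in> borel_measurable lborel"
      using square_integrable_measurable[OF F.square_integrable_W[OF zI_square_integrable, of x]]
      by measurable
    show "AE s in lborel. (if a < s \<and> s < b then zI s \<bullet> WY s else 0) = zI s \<bullet> F.W x zI s"
      using AE_WY_eq by eventually_elim (auto simp: zI_def indicator_def)
  qed
  finally show ?thesis
    by (simp add: RL2_inner_def PI_operator_fst_eq)
qed

lemma RL2_inner_scaled_nonneg:
  "0 \<le> RL2_inner a b (x, z) (PI_operator a b ((b - a) *\<^sub>R P) Q (\<lambda>s. transpose (Q s)) S R1 R2 (x, z))"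
  unfolding RL2_inner_PI_operator Pk_eq[symmetric]
  by (rule F.quadratic_form_nonneg[OF zI_square_integrable])

text \<open>As a compression of \<open>T\<close> the matrix \<open>P\<close> has a nonnegative form,
  and replacing \<open>(b - a) *\<^sub>R P\<close> by \<open>P\<close> adds a nonnegative multiple
  of that form as long as \<open>b - a\<close> is at most 1.\<close>

lemma RL2_inner_nonneg:
  assumes "b - a \<le> 1"
  shows "0 \<le> RL2_inner a b (x, z) (PI_operator a b P Q (\<lambda>s. transpose (Q s)) S R1 R2 (x, z))"
proof -
  have "x \<bullet> (P *v x) = (block_embedding ix1 *v x) \<bullet> (T *v (block_embedding ix1 *v x))"
    by (simp add: P_eq blk_eq_compression inner_matrix_vector_mult matrix_vector_mul_assoc matrix_mul_assoc
        del: transpose_matrix_vector)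
  then have "0 \<le> x \<bullet> (P *v x)"
    using T_psd by (simp add: psd_matrix_def)
  then have "0 \<le> (1 - (b - a)) * (x \<bullet> (P *v x))"
    using assms by simp
  also have "\<dots> = x \<bullet> (P *v x) - x \<bullet> (((b - a) *\<^sub>R P) *v x)"
    by (simp add: algebra_simps scaleR_matrix_vector_assoc[symmetric])
  finally show ?thesis
    using RL2_inner_scaled_nonneg by (simp add: RL2_inner_PI_operator inner_add_right)
qed

end

end

text \<open>Boundedness of \<open>Z1\<close> makes multiplication by it preserve square
  integrability, and square integrability of \<open>Z2\<close> makes its integral operators
  Hilbert-Schmidt. Polynomial data on a bounded interval satisfy both conditions.\<close>

theorem theorem3:
  fixes a b :: real
    and Z1 :: "real \<Rightarrow> real^'n^'d1"
    and Z2 :: "real \<Rightarrow> real \<Rightarrow> real^'n^'d2"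
    and T :: "real^('m::finite + 'd1::finite + 'd2::finite + 'd2)^('m + 'd1 + 'd2 + 'd2)"
    and P :: "real^'m^'m"
    and Q :: "real \<Rightarrow> real^'n^'m"
    and S :: "real \<Rightarrow> real^'n^'n"
    and R1 R2 :: "real \<Rightarrow> real \<Rightarrow> real^'n^'n"
  assumes ab: "a \<le> b"
    and Z1_measurable: "set_borel_measurable lborel {a..b} Z1"
    and Z1_bounded: "bounded (Z1 ` {a..b})"
    and Z2_square_integrable: "(\<lambda>(s, \<eta>). Z2 s \<eta>) \<in> square_integrable_on ({a..b} \<times> {a..b})"
    and T_psd: "psd_matrix T"
    and P_eq: "P = blk ix1 ix1 T"
    and Q_eq: "\<And>s. s \<in> {a..b} \<Longrightarrow>
      Q s = blk ix1 ix2 T ** Z1 s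
            + (LBINT \<eta>=s..b. blk ix1 ix3 T ** Z2 \<eta> s)
            + (LBINT \<eta>=a..s. blk ix1 ix4 T ** Z2 \<eta> s)"
    and S_eq: "\<And>s. s \<in> {a..b} \<Longrightarrow> S s = transpose (Z1 s) ** blk ix2 ix2 T ** Z1 s"
    and R1_eq: "\<And>s \<eta>. s \<in> {a..b} \<Longrightarrow> \<eta> \<in> {a..b} \<Longrightarrow>
      R1 s \<eta> = transpose (Z1 s) ** blk ix2 ix3 T ** Z2 s \<eta>
               + transpose (Z2 \<eta> s) ** blk ix4 ix2 T ** Z1 \<eta>
               + (LBINT \<theta>=s..b. transpose (Z2 \<theta> s) ** blk ix3 ix3 T ** Z2 \<theta> \<eta>)
               + (LBINT \<theta>=\<eta>..s. transpose (Z2 \<theta> s) ** blk ix4 ix3 T ** Z2 \<theta> \<eta>)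
               + (LBINT \<theta>=a..\<eta>. transpose (Z2 \<theta> s) ** blk ix4 ix4 T ** Z2 \<theta> \<eta>)"
    and R2_eq: "\<And>s \<eta>. s \<in> {a..b} \<Longrightarrow> \<eta> \<in> {a..b} \<Longrightarrow>
      R2 s \<eta> = transpose (Z1 s) ** blk ix2 ix4 T ** Z2 s \<eta>
               + transpose (Z2 \<eta> s) ** blk ix3 ix2 T ** Z1 \<eta>
               + (LBINT \<theta>=\<eta>..b. transpose (Z2 \<theta> s) ** blk ix3 ix3 T ** Z2 \<theta> \<eta>)
               + (LBINT \<theta>=s..\<eta>. transpose (Z2 \<theta> s) ** blk ix3 ix4 T ** Z2 \<theta> \<eta>)
               + (LBINT \<theta>=a..s. transpose (Z2 \<theta> s) ** blk ix4 ix4 T ** Z2 \<theta> \<eta>)"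
  shows "(b - a \<le> 1 \<longrightarrow>
            positive_operator (RL2 a b) (RL2_inner a b)
              (PI_operator a b P Q (\<lambda>s. transpose (Q s)) S R1 R2)) \<and>
         positive_operator (RL2 a b) (RL2_inner a b)
           (PI_operator a b ((b - a) *\<^sub>R P) Q (\<lambda>s. transpose (Q s)) S R1 R2)"
proof -
  interpret PI_block_data a b Z1 Z2 T P Q S R1 R2
    using assms by unfold_locales
  show ?thesis
    using PI_operator_in_RL2 RL2_inner_nonneg RL2_inner_scaled_nonneg
    unfolding positive_operator_def by (auto simp: RL2_def)
qed

end
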